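(* Let $\Omega\subset D_m$ be generic and $\Lambda=\{(t,x_t):t\in\mathbb{R}_+,x\in\Omega\}$. (i) Let $\phi$ be $\Lambda$-integrable. Then the map $\mathbf{I}_\phi:(t,x_t)\in\Lambda\mapsto\int_0^t\phi\,dx$ is continuous, differentiable and $\nabla_x\mathbf{I}_\phi=\phi_-$. (ii) Let $\phi:\Lambda\to\mathbb{R}^m$. If $F\in\mathcal{M}(\Lambda)$ is such that $\nabla_xF=\phi_-$, then $\phi$ is $\Lambda$-integrable and $$\int_0^t\phi\,dx=F(t,x_t)-F(0,x_0)\qquad\text{for all }(t,x_t)\in\Lambda .$$
   Context: Partitions: $\pi=(\pi_n)_{n\ge1}$ is a fixed sequence of partitions $\pi_n=(0=t^n_0<\dots<t^n_{k_n}<\infty)$ of $[0,\infty)$ with $t^n_{k_n}\to\infty$ and mesh vanishing on compacts; the superscript $n$ is dropped and sums involving $t_{i+1}$ run over $i<k_n$. Paths: $D_m$ is the space of càdlàg functions $[0,\infty)\to\mathbb{R}^m$, $x(0-):=x(0)$, $\Delta x(t):=x(t)-x(t-)$; $x_t(s):=x(s\wedge t)$, $x_{t-}(s):=x(s)1_{s<t}+x(t-)1_{s\ge t}$. $x^n:=\sum_{t_i\in\pi_n}x(t_{i+1})1_{[t_i,t_{i+1})}$, and $x^n_t,x^n_{t-}$ are the stopped versions of $x^n$. Generic sets: a nonempty $\Omega\subset D_m$ is generic if (i) for every $x\in\Omega$, $T>0$ there is $N$ with $x^n_T\in\Omega$ for all $n\ge N$; (ii) for every $x\in\Omega$, $t\ge0$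 there is a convex neighbourhood $\mathcal{U}$ of $0$ in $\mathbb{R}^m$ with $-\Delta x(t)\in\mathcal{U}$ and $x_t+e1_{[t,\infty)}\in\Omega$ for all $e\in\mathcal{U}$. Continuity of functionals $F$ on $\Lambda$: let $t'_n:=\max\{t_i<t:t_i\in\pi_n\}$ (and $0$ if there is no such $t_i$). $F$ is left-continuous if for all $(t,x_t)\in\Lambda$ ($x\in\Omega$): 1(a) $\lim_{s\uparrow t,\,s\le t}F(s,x_{s-})=F(t,x_{t-})$; 1(b) $\lim_{s\uparrow t,\,s<t}F(s,x_s)=F(t,x_{t-})$; 1(c) $t_n\to t$, $t_n\le t'_n$ implies $F(t_n,x^n_{t_n-})\to F(t,x_{t-})$; 1(d) $t_n\to t$, $t_n<t'_n$ implies $F(t_n,x^n_{t_n})\to F(t,x_{t-})$. $F$ is right-continuous if for all such $(t,x_t)$: 2(a) $\lim_{s\downarrow t,\,s\ge t}F(s,x_s)=F(t,x_t)$; 2(b) $\lim_{s\downarrow t,\,s>t}F(s,x_{s-})=F(t,x_t)$; 2(c) $t_n\to t$, $t_n\ge t'_n$ implies $F(t_n,x^n_{t_n})\to F(t,x_t)$; 2(d) $t_n\to t$, $t_n>t'_n$ implies $F(t_n,x^n_{t_n-})\to F(t,x_t)$. $F$ is continuous if it is both left- and right-continuous. Vector-valued functionals: componentwise. Notation: $F_-(t,x_t):=F(t,x_{t-})$; $F$ is strictly causal if $F=F_-$. Derivatives: $\mathcal{D}F(t,x_t):=\lim_{h\downarrow0}\frac{F(t+h,x_t)-F(t,x_t)}{h}$;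 $\nabla_xF(t,x_t)$ is the gradient at $e=0$ of $e\mapsto F(t,x_t+e1_{[t,\infty)})$. $F$ is differentiable if both exist at every point of $\Lambda$. Class $\mathcal{M}(\Lambda)$: continuous differentiable $F:\Lambda\to\mathbb{R}$ with $\mathcal{D}F=0$ and $\nabla_xF$ left-continuous and strictly causal. $\Lambda$-integrability: let $\phi:\Lambda\to\mathbb{R}^m$ with $\phi_-$ left-continuous, and for $x\in\Omega$ put $\mathbf{I}_\phi(t,x^n_t):=\sum_{\pi_n\ni t_i\le t}\phi(t_i,x^n_{t_i-})\cdot(x(t_{i+1})-x(t_i))$. $\phi$ is $\Lambda$-integrable if the limit $\mathbf{I}_\phi(t,x_t):=\lim_n\mathbf{I}_\phi(t,x^n_t)$ exists for each $(t,x_t)\in\Lambda$ and $\mathbf{I}_\phi:\Lambda\to\mathbb{R}$ is continuous; then one writes $\int_0^t\phi\,dx:=\mathbf{I}_\phi(t,x_t)$.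
   Formalization: In (i) the identity ∇_x I_φ = φ_- is stated for t > 0 only: at t = 0 the paths x_0 + e1_{[0,∞)} are constant, so ∇_x I_φ(0,x_0) = 0, while φ_-(0,x_0) = φ(0,x_0) can be nonzero (e.g. φ a nonzero constant on Ω = D_m). *)

theory Defs
  imports "HOL-Analysis.Analysis"
begin

text \<open>
  A path \<open>[0,\<infinity>) \<rightarrow> \<real>\<^sup>m\<close> is a function on \<^typ>\<open>real\<close> that vanishes on the negative half-line.
  This makes the encoding injective, and all operations on paths below preserve it.
  A functional on \<open>\<Lambda>\<close> is a total curried function of time and path. Only its values on \<open>\<Lambda>\<close>
  matter: paths approximating \<open>x \<in> \<Omega>\<close> lie in a generic \<open>\<Omega>\<close> for all large \<open>n\<close>, and the
  derivatives only look at points of \<open>\<Lambda>\<close> near the given one.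
\<close>

type_synonym 'm path = "real \<Rightarrow> real ^ 'm"

definition cadlag_paths :: "('m::finite) path set" where
  "cadlag_paths = {x. (\<forall>s<0. x s = 0) \<and>
     (\<forall>t\<ge>0. (x \<longlongrightarrow> x t) (at_right t)) \<and>
     (\<forall>t>0. \<exists>l. (x \<longlongrightarrow> l) (at_left t))}"

definition left_val :: "('m::finite) path \<Rightarrow> real \<Rightarrow> real ^ 'm" where
  "left_val x t = (if t \<le> 0 then x 0 else Lim (at_left t) x)"

definition jump :: "('m::finite) path \<Rightarrow> real \<Rightarrow> real ^ 'm" where
  "jump x t = x t - left_val x t"

definition stopped :: "('m::finite) path \<Rightarrow> real \<Rightarrow> 'm path" where
  "stopped x t = (\<lambda>s. x (min s t))"

definition stopped_left :: "('m::finite) path \<Rightarrow> real \<Rightarrow> 'm path" where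
  "stopped_left x t = (\<lambda>s. if s < t then x s else left_val x t)"

text \<open>The path \<open>x + e 1\<^bsub>[t,\<infinity>)\<^esub>\<close>.\<close>

definition bump :: "('m::finite) path \<Rightarrow> real \<Rightarrow> real ^ 'm \<Rightarrow> 'm path" where
  "bump x t e = (\<lambda>s. x s + indicator {t..} s *\<^sub>R e)"

text \<open>
  The partition \<open>\<pi>\<^sub>n\<close> is the strictly increasing list of its points \<open>t\<^sub>0, \<dots>, t\<^bsub>k\<^esub>\<close>, so
  \<open>i < k\<close> reads \<open>Suc i < length (\<pi> n)\<close>. The mesh condition covers every interval that
  starts in \<open>[0,T]\<close>, including one reaching beyond \<open>T\<close>.
\<close>

definition partition_seq :: "(nat \<Rightarrow> real list) \<Rightarrow> bool" where
  "partition_seq \<pi> \<longleftrightarrow>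
     (\<forall>n. \<pi> n \<noteq> [] \<and> hd (\<pi> n) = 0 \<and> sorted_wrt (<) (\<pi> n)) \<and>
     filterlim (\<lambda>n. last (\<pi> n)) at_top sequentially \<and>
     (\<forall>T\<ge>0. \<forall>\<epsilon>>0. \<forall>\<^sub>F n in sequentially. \<forall>i. Suc i < length (\<pi> n) \<and> \<pi> n ! i \<le> T
        \<longrightarrow> \<pi> n ! Suc i - \<pi> n ! i < \<epsilon>)"

definition step_path :: "(nat \<Rightarrow> real list) \<Rightarrow> nat \<Rightarrow> ('m::finite) path \<Rightarrow> 'm path" where
  "step_path \<pi> n x = (\<lambda>s. \<Sum>i | Suc i < length (\<pi> n).
     indicator {\<pi> n ! i ..< \<pi> n ! Suc i} s *\<^sub>R x (\<pi> n ! Suc i))"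

text \<open>The point \<open>t'\<^sub>n\<close>.\<close>

definition prev_pt :: "(nat \<Rightarrow> real list) \<Rightarrow> nat \<Rightarrow> real \<Rightarrow> real" where
  "prev_pt \<pi> n t =
     (if {s \<in> set (\<pi> n). s < t} = {} then 0 else Max {s \<in> set (\<pi> n). s < t})"

definition generic :: "(nat \<Rightarrow> real list) \<Rightarrow> ('m::finite) path set \<Rightarrow> bool" where
  "generic \<pi> \<Omega> \<longleftrightarrow> \<Omega> \<noteq> {} \<and> \<Omega> \<subseteq> cadlag_paths \<and>
     (\<forall>x\<in>\<Omega>. \<forall>T>0. \<exists>N. \<forall>n\<ge>N. stopped (step_path \<pi> n x) T \<in> \<Omega>) \<and>
     (\<forall>x\<in>\<Omega>. \<forall>t\<ge>0. \<exists>U. convex U \<and> 0 \<in> interior U \<and> - jump x t \<in> U \<and>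
        (\<forall>e\<in>U. bump (stopped x t) t e \<in> \<Omega>))"

definition Lambda :: "('m::finite) path set \<Rightarrow> (real \<times> 'm path) set" where
  "Lambda \<Omega> = {(t, stopped x t) | t x. 0 \<le> t \<and> x \<in> \<Omega>}"

text \<open>
  The limits 1(a), 1(b), 1(c), 1(d) and 2(a), 2(b), 2(c), 2(d), in this order. The filter
  \<^term>\<open>at t within S\<close> omits \<open>s = t\<close>; in 1(a) and 2(a), where \<open>s = t\<close> is allowed, the value
  there is the limit itself.
\<close>

definition left_cont ::
  "(nat \<Rightarrow> real list) \<Rightarrow> ('m::finite) path set \<Rightarrow>
   (real \<Rightarrow> 'm path \<Rightarrow> 'b::topological_space) \<Rightarrow> bool" where
  "left_cont \<pi> \<Omega> F \<longleftrightarrow> (\<forall>t\<ge>0. \<forall>x\<in>\<Omega>.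
     ((\<lambda>s. F s (stopped_left x s)) \<longlongrightarrow> F t (stopped_left x t)) (at t within {0..t}) \<and>
     ((\<lambda>s. F s (stopped x s)) \<longlongrightarrow> F t (stopped_left x t)) (at t within {0..<t}) \<and>
     (\<forall>u. u \<longlonglongrightarrow> t \<and> (\<forall>n. 0 \<le> u n \<and> u n \<le> prev_pt \<pi> n t) \<longrightarrow>
        (\<lambda>n. F (u n) (stopped_left (step_path \<pi> n x) (u n))) \<longlonglongrightarrow> F t (stopped_left x t)) \<and>
     (\<forall>u. u \<longlonglongrightarrow> t \<and> (\<forall>n. 0 \<le> u n \<and> u n < prev_pt \<pi> n t) \<longrightarrow>
        (\<lambda>n. F (u n) (stopped (step_path \<pi> n x) (u n))) \<longlonglongrightarrow> F t (stopped_left x t)))"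

definition right_cont ::
  "(nat \<Rightarrow> real list) \<Rightarrow> ('m::finite) path set \<Rightarrow>
   (real \<Rightarrow> 'm path \<Rightarrow> 'b::topological_space) \<Rightarrow> bool" where
  "right_cont \<pi> \<Omega> F \<longleftrightarrow> (\<forall>t\<ge>0. \<forall>x\<in>\<Omega>.
     ((\<lambda>s. F s (stopped x s)) \<longlongrightarrow> F t (stopped x t)) (at t within {t..}) \<and>
     ((\<lambda>s. F s (stopped_left x s)) \<longlongrightarrow> F t (stopped x t)) (at t within {t<..}) \<and>
     (\<forall>u. u \<longlonglongrightarrow> t \<and> (\<forall>n. 0 \<le> u n \<and> u n \<ge> prev_pt \<pi> n t) \<longrightarrow>
        (\<lambda>n. F (u n) (stopped (step_path \<pi> n x) (u n))) \<longlonglongrightarrow> F t (stopped x t)) \<and>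
     (\<forall>u. u \<longlonglongrightarrow> t \<and> (\<forall>n. 0 \<le> u n \<and> u n > prev_pt \<pi> n t) \<longrightarrow>
        (\<lambda>n. F (u n) (stopped_left (step_path \<pi> n x) (u n))) \<longlonglongrightarrow> F t (stopped x t)))"

definition cont_functional ::
  "(nat \<Rightarrow> real list) \<Rightarrow> ('m::finite) path set \<Rightarrow>
   (real \<Rightarrow> 'm path \<Rightarrow> 'b::topological_space) \<Rightarrow> bool" where
  "cont_functional \<pi> \<Omega> F \<longleftrightarrow> left_cont \<pi> \<Omega> F \<and> right_cont \<pi> \<Omega> F"

text \<open>The functional \<open>F\<^sub>-\<close>; on \<open>\<Lambda>\<close> one has \<open>(x\<^sub>t)\<^bsub>t-\<^esub> = x\<^bsub>t-\<^esub>\<close>.\<close>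

definition left_version ::
  "(real \<Rightarrow> ('m::finite) path \<Rightarrow> 'b) \<Rightarrow> real \<Rightarrow> 'm path \<Rightarrow> 'b" where
  "left_version F t y = F t (stopped_left y t)"

definition strictly_causal ::
  "('m::finite) path set \<Rightarrow> (real \<Rightarrow> 'm path \<Rightarrow> 'b) \<Rightarrow> bool" where
  "strictly_causal \<Omega> F \<longleftrightarrow> (\<forall>(t, y)\<in>Lambda \<Omega>. F t y = left_version F t y)"

definition has_hderiv ::
  "(real \<Rightarrow> ('m::finite) path \<Rightarrow> real) \<Rightarrow> real \<Rightarrow> 'm path \<Rightarrow> real \<Rightarrow> bool" where
  "has_hderiv F t y d \<longleftrightarrow> ((\<lambda>h. (F (t + h) y - F t y) / h) \<longlongrightarrow> d) (at_right 0)"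

definition hderiv :: "(real \<Rightarrow> ('m::finite) path \<Rightarrow> real) \<Rightarrow> real \<Rightarrow> 'm path \<Rightarrow> real" where
  "hderiv F t y = (THE d. has_hderiv F t y d)"

definition has_vgrad ::
  "(real \<Rightarrow> ('m::finite) path \<Rightarrow> real) \<Rightarrow> real \<Rightarrow> 'm path \<Rightarrow> real ^ 'm \<Rightarrow> bool" where
  "has_vgrad F t y g \<longleftrightarrow> GDERIV (\<lambda>e. F t (bump y t e)) 0 :> g"

definition vgrad :: "(real \<Rightarrow> ('m::finite) path \<Rightarrow> real) \<Rightarrow> real \<Rightarrow> 'm path \<Rightarrow> real ^ 'm" where
  "vgrad F t y = (THE g. has_vgrad F t y g)"

definition differentiable_functional ::
  "('m::finite) path set \<Rightarrow> (real \<Rightarrow> 'm path \<Rightarrow> real) \<Rightarrow> bool" where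
  "differentiable_functional \<Omega> F \<longleftrightarrow>
     (\<forall>(t, y)\<in>Lambda \<Omega>. (\<exists>d. has_hderiv F t y d) \<and> (\<exists>g. has_vgrad F t y g))"

definition class_M ::
  "(nat \<Rightarrow> real list) \<Rightarrow> ('m::finite) path set \<Rightarrow> (real \<Rightarrow> 'm path \<Rightarrow> real) set" where
  "class_M \<pi> \<Omega> = {F. cont_functional \<pi> \<Omega> F \<and> differentiable_functional \<Omega> F \<and>
     (\<forall>(t, y)\<in>Lambda \<Omega>. hderiv F t y = 0) \<and>
     left_cont \<pi> \<Omega> (vgrad F) \<and> strictly_causal \<Omega> (vgrad F)}"

definition riemann_sum ::
  "(nat \<Rightarrow> real list) \<Rightarrow> nat \<Rightarrow> (real \<Rightarrow> ('m::finite) path \<Rightarrow> real ^ 'm) \<Rightarrow>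
   real \<Rightarrow> 'm path \<Rightarrow> real" where
  "riemann_sum \<pi> n \<phi> t x = (\<Sum>i | Suc i < length (\<pi> n) \<and> \<pi> n ! i \<le> t.
     \<phi> (\<pi> n ! i) (stopped_left (step_path \<pi> n x) (\<pi> n ! i)) \<bullet> (x (\<pi> n ! Suc i) - x (\<pi> n ! i)))"

definition path_integral ::
  "(nat \<Rightarrow> real list) \<Rightarrow> (real \<Rightarrow> ('m::finite) path \<Rightarrow> real ^ 'm) \<Rightarrow>
   real \<Rightarrow> 'm path \<Rightarrow> real" where
  "path_integral \<pi> \<phi> t y = lim (\<lambda>n. riemann_sum \<pi> n \<phi> t y)"

text \<open>
  At \<open>t = 0\<close> the path \<open>x\<^sub>0 + e 1\<^bsub>[0,\<infinity>)\<^esub>\<close> is constant, so all its sums vanish and the gradient of the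
  integral is \<open>0\<close> there, whatever \<open>\<phi>\<close> is. It can equal \<open>\<phi>\<^sub>-\<close> for general \<open>\<phi>\<close> only at \<open>t > 0\<close>.
\<close>

text \<open>
  The last summand of the sum for \<open>x\<close> uses \<open>x\<close> at a point after \<open>t\<close>. That the limit defines a
  functional of \<open>(t, x\<^sub>t)\<close> means that it is the same for \<open>x\<close> and for \<open>x\<^sub>t\<close>, which is required here.
\<close>

definition Lambda_integrable ::
  "(nat \<Rightarrow> real list) \<Rightarrow> ('m::finite) path set \<Rightarrow> (real \<Rightarrow> 'm path \<Rightarrow> real ^ 'm) \<Rightarrow> bool" where
  "Lambda_integrable \<pi> \<Omega> \<phi> \<longleftrightarrow> left_cont \<pi> \<Omega> (left_version \<phi>) \<and>
     (\<forall>t\<ge>0. \<forall>x\<in>\<Omega>. (\<lambda>n. riemann_sum \<pi> n \<phi> t x) \<longlonglongrightarrow> path_integral \<pi> \<phi> t (stopped x t)) \<and>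
     cont_functional \<pi> \<Omega> (path_integral \<pi> \<phi>)"

end

theory Submission
  imports Defs
begin

text \<open>
  A step path \<open>x\<^sup>n\<close> is constant between partition points and jumps by \<open>x(t\<^bsub>i+1\<^esub>) - x(t\<^sub>i)\<close> at
  \<open>t\<^sub>i > 0\<close>. For (i), adding \<open>e 1\<^bsub>[t,\<infinity>)\<^esub>\<close> to a path stopped at \<open>t > 0\<close> changes a single
  increment of the Riemann sum, namely the one starting at \<open>t'\<^sub>n\<close>, and changes no integrand; hence
  \<open>e \<mapsto> I\<^sub>\<phi>(t, x\<^sub>t + e 1\<^bsub>[t,\<infinity>)\<^esub>)\<close> is affine with slope \<open>lim \<phi>(t'\<^sub>n, x\<^sup>n\<^bsub>t'\<^sub>n-\<^esub>) = \<phi>\<^sub>-(t, x\<^sub>t)\<close>.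
  For (ii), \<open>F\<close> is constant along the flat pieces of \<open>x\<^sup>n\<close> because its horizontal derivative vanishes,
  and affine across each jump because its gradient there depends only on the path before the jump.
  So \<open>F(t, x\<^sup>n\<^sub>t) - F(0, x\<^sup>n\<^sub>0)\<close> equals the Riemann sum without its summand at \<open>t\<^sub>0 = 0\<close>, which tends
  to \<open>0\<close> by right-continuity of \<open>x\<close> and left-continuity of \<open>\<phi>\<^sub>-\<close> at time \<open>0\<close>.
\<close>

section \<open>Stopped paths\<close>

text \<open>For \<open>t > 0\<close> both values are \<open>Lim\<close> of predicates that agree for
  every candidate limit, so no limit needs to exist. For \<open>t \<le> 0\<close> the convention
  x(0-) = x(0) is in force, and the value at 0 is not covered by times before \<open>t\<close>;
  hence the second hypothesis.\<close>

lemma left_val_cong: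
  assumes "\<And>s. s < t \<Longrightarrow> x s = y s" and "t \<le> 0 \<Longrightarrow> x 0 = y 0"
  shows "left_val x t = left_val y t"
proof (cases "t \<le> 0")
  case False
  have "eventually (\<lambda>s. x s = y s) (at_left t)"
    using assms(1) by (auto simp: eventually_at_filter)
  then have "(x \<longlongrightarrow> l) (at_left t) = (y \<longlongrightarrow> l) (at_left t)" for l
    by (rule tendsto_cong)
  then show ?thesis
    using False by (simp add: left_val_def Topological_Spaces.Lim_def)
qed (use assms in \<open>auto simp: left_val_def\<close>)

lemma left_val_eqI:
  assumes "0 < t" and "a < t" and "\<And>s. a \<le> s \<Longrightarrow> s < t \<Longrightarrow> x s = c"
  shows "left_val x t = c"
proof -
  have "eventually (\<lambda>s. x s = c) (at_left t)"
    using assms by (auto simp: eventually_at_left intro!: exI[of _ a])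
  then have "(x \<longlongrightarrow> c) (at_left t)"
    by (rule tendsto_eventually)
  then show ?thesis
    using assms(1) by (simp add: left_val_def tendsto_Lim)
qed

lemma stopped_left_cong:
  assumes "\<And>s. s < t \<Longrightarrow> x s = y s" and "t \<le> 0 \<Longrightarrow> x 0 = y 0"
  shows "stopped_left x t = stopped_left y t"
  using left_val_cong[of t x y] assms by (auto simp: stopped_left_def)

lemma stopped_left_stopped_left [simp]: "stopped_left (stopped_left x t) t = stopped_left x t"
proof -
  have "left_val (stopped_left x t) t = left_val x t"
  proof (cases "t \<le> 0")
    case True
    then show ?thesis
      by (simp add: left_val_def stopped_left_def)
  qed (auto intro!: left_val_cong simp: stopped_left_def)
  then show ?thesis
    by (simp add: stopped_left_def[of _ t] fun_eq_iff)
qed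

lemma stopped_left_stopped: "t \<le> T \<Longrightarrow> 0 \<le> T \<Longrightarrow> stopped_left (stopped x T) t = stopped_left x t"
  by (rule stopped_left_cong) (auto simp: stopped_def)

lemma stopped_stopped: "t \<le> T \<Longrightarrow> stopped (stopped x T) t = stopped x t"
  by (auto simp: stopped_def)

text \<open>At \<open>t = 0\<close> this rests on the convention x(0-) = x(0). It makes the initial
  value the same for a path and for its left-stopped version.\<close>

lemma stopped_stopped_left_zero: "0 \<le> t \<Longrightarrow> stopped (stopped_left x t) 0 = stopped x 0"
  by (auto simp: stopped_def stopped_left_def left_val_def min_def)

lemma stopped_stopped_left_self: "stopped (stopped_left x t) t = stopped_left x t"
  by (auto simp: stopped_def stopped_left_def min_def)

lemma stopped_bump_self: "stopped (bump (stopped x t) t e) t = bump (stopped x t) t e"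
  by (auto simp: stopped_def bump_def indicator_def min_def)

text \<open>Positivity of \<open>t\<close> matters: at time 0 the left value is by convention the
  value itself, so a bump there would survive.\<close>

lemma stopped_left_bump:
  "0 < t \<Longrightarrow> stopped_left (bump x t e) t = stopped_left x t"
  by (rule stopped_left_cong) (auto simp: bump_def)

lemma jump_stopped: "t \<le> T \<Longrightarrow> 0 \<le> T \<Longrightarrow> jump (stopped x T) t = jump x t"
  using left_val_cong[of t "stopped x T" x] by (auto simp: jump_def stopped_def)

lemma bump_zero [simp]: "bump x t 0 = x"
  by (simp add: bump_def)

lemma bump_bump: "bump (bump x t e) t e' = bump x t (e + e')"
  by (auto simp: bump_def scaleR_add_right)

text \<open>Links the requirement \<open>- jump x t \<in> U\<close> in \<open>generic\<close> to
  stopping from the left.\<close>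

lemma bump_minus_jump: "bump (stopped x t) t (- jump x t) = stopped_left x t"
  by (auto simp: bump_def stopped_def stopped_left_def jump_def indicator_def)

section \<open>Generic sets\<close>

lemma generic_bump:
  assumes "generic \<pi> \<Omega>" and "x \<in> \<Omega>" and "0 \<le> t"
  obtains U where "convex U" and "0 \<in> interior U" and "- jump x t \<in> U"
    and "\<And>e. e \<in> U \<Longrightarrow> bump (stopped x t) t e \<in> \<Omega>"
  using assms unfolding generic_def by meson

text \<open>Genericity speaks of bumped stopped paths. The bump \<open>e = 0\<close> gives the
  stopped path, and the bump \<open>- jump x t\<close> gives the left-stopped one in the next
  lemma.\<close>

lemma generic_stopped:
  assumes "generic \<pi> \<Omega>" and "x \<in> \<Omega>" and "0 \<le> t"
  shows "stopped x t \<in> \<Omega>"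
  using generic_bump[OF assms] interior_subset by (metis bump_zero subsetD)

lemma generic_stopped_left:
  assumes "generic \<pi> \<Omega>" and "x \<in> \<Omega>" and "0 \<le> t"
  shows "stopped_left x t \<in> \<Omega>"
  using generic_bump[OF assms] by (metis bump_minus_jump)

text \<open>Genericity controls step paths stopped at a fixed horizon. The horizon
  \<open>t + 1\<close> eventually exceeds \<open>u n\<close>, and stopping once more at
  \<open>u n\<close> stays inside \<open>\<Omega>\<close>.\<close>

lemma generic_step:
  assumes "generic \<pi> \<Omega>" and "x \<in> \<Omega>" and "u \<longlonglongrightarrow> t" and "\<And>n. 0 \<le> u n"
  shows "\<forall>\<^sub>F n in sequentially. stopped (step_path \<pi> n x) (u n) \<in> \<Omega> \<and>
    stopped_left (step_path \<pi> n x) (u n) \<in> \<Omega>"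
proof -
  have "0 \<le> t"
    using assms(3,4) by (meson LIMSEQ_le_const)
  then obtain N where "\<And>n. n \<ge> N \<Longrightarrow> stopped (step_path \<pi> n x) (t + 1) \<in> \<Omega>"
    using assms(1,2) unfolding generic_def by (metis add_nonneg_pos zero_less_one)
  then have "\<forall>\<^sub>F n in sequentially. stopped (step_path \<pi> n x) (t + 1) \<in> \<Omega>"
    using eventually_sequentially by blast
  moreover have "\<forall>\<^sub>F n in sequentially. u n < t + 1"
    using assms(3) by (rule order_tendstoD) simp
  ultimately show ?thesis
  proof eventually_elim
    case (elim n)
    then show ?case
      using generic_stopped[OF assms(1) elim(1) assms(4)[of n]]
        generic_stopped_left[OF assms(1) elim(1) assms(4)[of n]] \<open>0 \<le> t\<close>
      by (simp add: stopped_stopped stopped_left_stopped)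
  qed
qed

lemma cadlag_tendsto_right:
  assumes "x \<in> cadlag_paths" and "0 \<le> t"
  shows "(x \<longlongrightarrow> x t) (at_right t)"
  using assms by (simp add: cadlag_paths_def)

lemma Lambda_iff: "(t, y) \<in> Lambda \<Omega> \<longleftrightarrow> 0 \<le> t \<and> (\<exists>x\<in>\<Omega>. y = stopped x t)"
  by (auto simp: Lambda_def)

lemma LambdaI: "0 \<le> t \<Longrightarrow> y \<in> \<Omega> \<Longrightarrow> stopped y t = y \<Longrightarrow> (t, y) \<in> Lambda \<Omega>"
  by (metis Lambda_iff)

text \<open>The third clause of \<open>left_cont\<close>; it is applied later to
  \<open>prev_pt \<pi> n t\<close> and to the constant sequence 0.\<close>

lemma left_cont_step_path:
  assumes "left_cont \<pi> \<Omega> F" and "0 \<le> t" and "x \<in> \<Omega>" and "u \<longlonglongrightarrow> t"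
    and "\<And>n. 0 \<le> u n" and "\<And>n. u n \<le> prev_pt \<pi> n t"
  shows "(\<lambda>n. F (u n) (stopped_left (step_path \<pi> n x) (u n))) \<longlonglongrightarrow> F t (stopped_left x t)"
  using assms unfolding left_cont_def by blast

text \<open>The third clause of \<open>right_cont\<close>; it is applied later to constant
  sequences.\<close>

lemma right_cont_step_path:
  assumes "right_cont \<pi> \<Omega> F" and "0 \<le> t" and "x \<in> \<Omega>" and "u \<longlonglongrightarrow> t"
    and "\<And>n. 0 \<le> u n" and "\<And>n. u n \<ge> prev_pt \<pi> n t"
  shows "(\<lambda>n. F (u n) (stopped (step_path \<pi> n x) (u n))) \<longlonglongrightarrow> F t (stopped x t)"
  using assms unfolding right_cont_def by blast

section \<open>Derivatives of functionals\<close>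

lemma has_hderiv_unique: "has_hderiv F t y d \<Longrightarrow> has_hderiv F t y d' \<Longrightarrow> d = d'"
  unfolding has_hderiv_def by (rule tendsto_unique[OF trivial_limit_at_right_real])

lemma hderiv_eq:
  assumes "has_hderiv F t y d"
  shows "hderiv F t y = d"
  unfolding hderiv_def using assms by (rule the_equality) (erule has_hderiv_unique[OF _ assms])

lemma has_vgrad_unique:
  assumes "has_vgrad F t y g" and "has_vgrad F t y g'"
  shows "g = g'"
proof -
  have "(\<lambda>h. h \<bullet> g) = (\<lambda>h. h \<bullet> g')"
    using assms unfolding has_vgrad_def gderiv_def by (rule has_derivative_unique)
  then have "h \<bullet> g = h \<bullet> g'" for h
    by (rule fun_cong)
  then show ?thesis
    by (rule iffD1[OF vector_eq_ldot, OF allI])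
qed

lemma vgrad_eq:
  assumes "has_vgrad F t y g"
  shows "vgrad F t y = g"
  unfolding vgrad_def using assms by (rule the_equality) (erule has_vgrad_unique[OF _ assms])

text \<open>The gradient sees only small \<open>e\<close>, so an affine formula on a neighbourhood
  of 0 suffices. Genericity provides bumped paths in \<open>\<Omega>\<close> only on such a
  neighbourhood.\<close>

lemma has_vgrad_affine:
  assumes "0 \<in> interior U" and "\<And>e. e \<in> U \<Longrightarrow> F t (bump y t e) = c + g \<bullet> e"
  shows "has_vgrad F t y g"
proof -
  have "((\<lambda>e. c + g \<bullet> e) has_derivative (\<lambda>h. h \<bullet> g)) (at 0)"
    by (auto intro!: derivative_eq_intros simp: inner_commute)
  moreover have "c + g \<bullet> e = F t (bump y t e)" if "e \<in> interior U" for e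
    using assms(2)[of e] subsetD[OF interior_subset that] by simp
  ultimately show ?thesis
    unfolding has_vgrad_def gderiv_def
    by (rule has_derivative_transform_within_open[OF _ open_interior assms(1)])
qed

text \<open>Bumps at the same time add up, so the gradient at an already bumped path is a derivative
  of the original map at the point \<open>e\<close>, by translation.\<close>

lemma has_derivative_bump:
  assumes "has_vgrad F t (bump y t e) g"
  shows "((\<lambda>e. F t (bump y t e)) has_derivative (\<lambda>h. h \<bullet> g)) (at e)"
proof -
  have "((\<lambda>e'. F t (bump y t (e + e'))) has_derivative (\<lambda>h. h \<bullet> g)) (at (e - e))"
    using assms by (simp add: has_vgrad_def gderiv_def bump_bump)
  moreover have "((\<lambda>e'. e' - e) has_derivative (\<lambda>h. h)) (at e)"
    by (auto intro!: derivative_eq_intros)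
  ultimately show ?thesis
    using has_derivative_compose[of "\<lambda>e'. e' - e" "\<lambda>h. h" e UNIV
        "\<lambda>e'. F t (bump y t (e + e'))" "\<lambda>h. h \<bullet> g"] by simp
qed

section \<open>Real functions with vanishing right derivative\<close>

text \<open>Adding a small slope \<open>k\<close> to \<open>f\<close> makes the right derivative
  positive. The last point at which the tilted function is at least its initial value must then be
  \<open>b\<close>, since to the right of an earlier point it would still increase. Letting the
  slope tend to 0 gives the claim.\<close>

lemma nondecreasing_of_right_deriv_zero:
  fixes f :: "real \<Rightarrow> real"
  assumes "a \<le> b" and cont: "continuous_on {a..b} f"
    and deriv: "\<And>s. a \<le> s \<Longrightarrow> s < b \<Longrightarrow> ((\<lambda>h. (f (s + h) - f s) / h) \<longlongrightarrow> 0) (at_right 0)"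
  shows "f a \<le> f b"
proof -
  have "f a \<le> f b + \<epsilon>" if "\<epsilon> > 0" for \<epsilon>
  proof -
    \<comment> \<open>The slope costs at most \<open>\<epsilon>\<close> over the whole interval; the
      summand 1 keeps the denominator positive when \<open>a = b\<close>.\<close>
    define k where "k = \<epsilon> / (b - a + 1)"
    have k: "k > 0" "k * (b - a) \<le> \<epsilon>"
      using that \<open>a \<le> b\<close> by (auto simp: k_def field_simps)
    define g where "g s = f s + k * s" for s
    define S where "S = {s \<in> {a..b}. g a \<le> g s}"
    have "compact S"
    proof -
      have "continuous_on {a..b} g"
        unfolding g_def by (intro continuous_intros cont)
      then have "closed S"
        unfolding S_def by (intro continuous_on_closed_Collect_le continuous_intros) auto
      moreover have "bounded S"
        unfolding S_def by (rule bounded_subset[of "{a..b}"]) auto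
      ultimately show ?thesis
        by (simp add: compact_eq_bounded_closed)
    qed
    moreover have "S \<noteq> {}"
      using \<open>a \<le> b\<close> by (auto simp: S_def)
    ultimately obtain m where m: "m \<in> S" "\<And>s. s \<in> S \<Longrightarrow> s \<le> m"
      by (meson compact_attains_sup)
    have "m = b"
    proof (rule ccontr)
      assume "m \<noteq> b"
      then have "m < b" "a \<le> m"
        using m(1) by (auto simp: S_def)
      have "\<forall>\<^sub>F h in at_right 0. - k < (f (m + h) - f m) / h"
        using order_tendstoD(1)[OF deriv[OF \<open>a \<le> m\<close> \<open>m < b\<close>]] k(1) by simp
      moreover have "\<forall>\<^sub>F h in at_right 0. 0 < h \<and> h < b - m"
        using \<open>m < b\<close> by (auto simp: eventually_at_right_field intro!: exI[of _ "b - m"])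
      ultimately have "\<forall>\<^sub>F h in at_right 0. - k < (f (m + h) - f m) / h \<and> 0 < h \<and> h < b - m"
        by eventually_elim auto
      then obtain h where h: "- k < (f (m + h) - f m) / h" "0 < h" "h < b - m"
        using eventually_happens trivial_limit_at_right_real by blast
      then have "g m < g (m + h)"
        by (auto simp: g_def field_simps)
      then have "m + h \<in> S"
        using m(1) h by (auto simp: S_def)
      then show False
        using m(2) h(2) by force
    qed
    then have "g a \<le> g b"
      using m(1) by (simp add: S_def)
    then show ?thesis
      using k by (auto simp: g_def algebra_simps)
  qed
  then show ?thesis
    by (rule field_le_epsilon)
qed

lemma constant_of_right_deriv_zero:
  fixes f :: "real \<Rightarrow> real"
  assumes "a \<le> b" and "continuous_on {a..b} f"
    and deriv: "\<And>s. a \<le> s \<Longrightarrow> s < b \<Longrightarrow> ((\<lambda>h. (f (s + h) - f s) / h) \<longlongrightarrow> 0) (at_right 0)"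
  shows "f b = f a"
proof (rule antisym)
  show "f a \<le> f b"
    using assms by (rule nondecreasing_of_right_deriv_zero)
  have "- f a \<le> - f b"
  proof (rule nondecreasing_of_right_deriv_zero[OF \<open>a \<le> b\<close>])
    show "continuous_on {a..b} (\<lambda>s. - f s)"
      using assms(2) by (rule continuous_on_minus)
    show "((\<lambda>h. (- f (s + h) - - f s) / h) \<longlongrightarrow> 0) (at_right 0)" if "a \<le> s" "s < b" for s
      using tendsto_minus[OF deriv[OF that]] by (simp add: minus_divide_left)
  qed
  then show "f b \<le> f a"
    by simp
qed

section \<open>Functionals along flat pieces and across jumps\<close>

text \<open>From \<open>a\<close> on, the path equals its own stopped versions, so all points
  \<open>(s, w)\<close> lie in \<open>Lambda \<Omega>\<close> and the horizontal derivative is the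
  right derivative of \<open>s \<mapsto> F s w\<close>. Continuity of this function comes from
  right-continuity of \<open>F\<close> and, after \<open>a\<close>, from left-continuity, as there
  is no jump.\<close>

lemma flat_path_constant:
  assumes cont: "cont_functional \<pi> \<Omega> F" and diff: "differentiable_functional \<Omega> F"
    and zero: "\<forall>(t, y)\<in>Lambda \<Omega>. hderiv F t y = 0"
    and "w \<in> \<Omega>" and flat: "stopped w a = w" and "0 \<le> a" and "a \<le> b"
  shows "F b w = F a w"
proof (rule constant_of_right_deriv_zero[OF \<open>a \<le> b\<close>])
  have flat_ge: "stopped w s = w" if "a \<le> s" for s
  proof
    fix r
    have "w r = w (min r a)" "w (min r s) = w (min (min r s) a)"
      using flat by (metis stopped_def)+
    then show "stopped w s r = w r"
      using that by (simp add: stopped_def min.absorb2 min.assoc)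
  qed
  show "((\<lambda>h. (F (s + h) w - F s w) / h) \<longlongrightarrow> 0) (at_right 0)" if "a \<le> s" for s
  proof -
    have "(s, w) \<in> Lambda \<Omega>"
      using that \<open>w \<in> \<Omega>\<close> \<open>0 \<le> a\<close> flat_ge by (auto intro!: LambdaI)
    then obtain d where d: "has_hderiv F s w d" and "hderiv F s w = 0"
      using diff zero unfolding differentiable_functional_def by blast
    then have "has_hderiv F s w 0"
      using hderiv_eq[OF d] by simp
    then show ?thesis
      by (simp add: has_hderiv_def)
  qed
  show "continuous_on {a..b} (\<lambda>s. F s w)"
    unfolding continuous_on_eq_continuous_within continuous_within
  proof
    fix s
    assume "s \<in> {a..b}"
    then have s: "a \<le> s" "0 \<le> s"
      using \<open>0 \<le> a\<close> by auto
    have "((\<lambda>r. F r (stopped w r)) \<longlongrightarrow> F s (stopped w s)) (at s within {s..})"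
      using cont s \<open>w \<in> \<Omega>\<close> unfolding cont_functional_def right_cont_def by blast
    then have "((\<lambda>r. F r (stopped w r)) \<longlongrightarrow> F s w) (at s within {s..})"
      by (simp add: flat_ge[OF s(1)])
    then have "((\<lambda>r. F r (stopped w r)) \<longlongrightarrow> F s w) (at s within {s..b})"
      by (rule tendsto_within_subset) auto
    \<comment> \<open>The path may jump at \<open>a\<close> itself, but for \<open>s = a\<close> the
      set \<open>{a..<s}\<close> is empty and nothing is asked from the left.\<close>
    moreover have "((\<lambda>r. F r (stopped w r)) \<longlongrightarrow> F s w) (at s within {a..<s})"
    proof (cases "a = s")
      case False
      have "stopped_left w s = w"
      proof -
        have "left_val w s = w s"
        proof (rule left_val_eqI)
          show "a < s" "0 < s"
            using s False \<open>0 \<le> a\<close> by auto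
          show "w r = w s" if "a \<le> r" "r < s" for r
            using flat_ge[OF that(1)] that by (metis less_imp_le min.absorb2 stopped_def)
        qed
        moreover have "w r = w s" if "s \<le> r" for r
          using flat_ge[OF s(1)] that by (metis min.absorb2 stopped_def)
        ultimately show ?thesis
          unfolding stopped_left_def by (intro ext) (metis not_le)
      qed
      moreover have "((\<lambda>r. F r (stopped w r)) \<longlongrightarrow> F s (stopped_left w s)) (at s within {0..<s})"
        using cont s \<open>w \<in> \<Omega>\<close> unfolding cont_functional_def left_cont_def by blast
      ultimately have "((\<lambda>r. F r (stopped w r)) \<longlongrightarrow> F s w) (at s within {0..<s})"
        by simp
      then show ?thesis
        by (rule tendsto_within_subset) (use \<open>0 \<le> a\<close> in auto)
    qed simp
    ultimately have "((\<lambda>r. F r (stopped w r)) \<longlongrightarrow> F s w) (at s within {a..<s} \<union> {s..b})"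
      by (simp add: Lim_within_Un)
    then have "((\<lambda>r. F r (stopped w r)) \<longlongrightarrow> F s w) (at s within {a..b})"
      by (rule tendsto_within_subset) auto
    moreover have "\<forall>\<^sub>F r in at s within {a..b}. F r (stopped w r) = F r w"
      using flat_ge by (auto simp: eventually_at_filter)
    ultimately show "((\<lambda>r. F r w) \<longlongrightarrow> F s w) (at s within {a..b})"
      by (rule Lim_transform_eventually)
  qed
qed

text \<open>All bumped paths agree before \<open>t\<close>, and the gradient there depends only on
  that part. So \<open>F\<close> has one and the same gradient along the segment from the
  left-stopped path to the stopped one, and is affine on it.\<close>

lemma jump_increment:
  assumes gen: "generic \<pi> \<Omega>" and diff: "differentiable_functional \<Omega> F"
    and grad: "\<forall>(t, y)\<in>Lambda \<Omega>. vgrad F t y = left_version \<phi> t y"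
    and "w \<in> \<Omega>" and "0 < t"
  shows "F t (stopped w t) - F t (stopped_left w t) = \<phi> t (stopped_left w t) \<bullet> jump w t"
proof -
  obtain U where U: "convex U" "0 \<in> interior U" "- jump w t \<in> U"
    "\<And>e. e \<in> U \<Longrightarrow> bump (stopped w t) t e \<in> \<Omega>"
    using generic_bump[OF gen \<open>w \<in> \<Omega>\<close>] \<open>0 < t\<close> by (metis less_imp_le)
  define g where "g = \<phi> t (stopped_left w t)"
  define y where "y = stopped w t"
  have deriv: "((\<lambda>e. F t (bump y t e)) has_derivative (\<lambda>h. h \<bullet> g)) (at e)" if "e \<in> U" for e
  proof -
    have mem: "(t, bump y t e) \<in> Lambda \<Omega>"
      using U(4)[OF that] \<open>0 < t\<close> by (auto simp: y_def stopped_bump_self intro!: LambdaI)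
    then obtain g' where "has_vgrad F t (bump y t e) g'"
      using diff unfolding differentiable_functional_def by blast
    moreover have "vgrad F t (bump y t e) = g"
      using grad mem \<open>0 < t\<close>
      by (auto simp: left_version_def g_def y_def stopped_left_bump stopped_left_stopped)
    ultimately show ?thesis
      using vgrad_eq has_derivative_bump by metis
  qed
  define J where "J = jump w t"
  \<comment> \<open>At \<open>r = 0\<close> the jump is removed, at \<open>r = 1\<close> the path is
    unchanged. The expected linear growth is subtracted, so \<open>f\<close> should be
    constant.\<close>
  define f where "f r = F t (bump y t ((r - 1) *\<^sub>R J)) - r * (J \<bullet> g)" for r
  have "(f has_derivative (\<lambda>h. 0)) (at r within {0..1})" if r: "r \<in> {0..1}" for r
  proof -
    have "0 \<in> U"
      using U(2) interior_subset by blast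
    \<comment> \<open>Convexity of \<open>U\<close> keeps the whole segment between
      \<open>- J\<close> and 0 inside the set of admissible bumps.\<close>
    then have "r *\<^sub>R 0 + (1 - r) *\<^sub>R (- J) \<in> U"
      using U(1,3) r unfolding J_def by (intro convexD) auto
    then have "(r - 1) *\<^sub>R J \<in> U"
      by (simp add: algebra_simps)
    from deriv[OF this] have "((\<lambda>r. F t (bump y t ((r - 1) *\<^sub>R J))) has_derivative (\<lambda>h. (h *\<^sub>R J) \<bullet> g))
      (at r within {0..1})"
      by (rule has_derivative_compose[rotated]) (auto intro!: derivative_eq_intros)
    moreover have "((\<lambda>r. r * (J \<bullet> g)) has_derivative (\<lambda>h. h * (J \<bullet> g))) (at r within {0..1})"
      by (auto intro!: derivative_eq_intros)
    ultimately have "(f has_derivative (\<lambda>h. (h *\<^sub>R J) \<bullet> g - h * (J \<bullet> g))) (at r within {0..1})"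
      unfolding f_def by (rule has_derivative_diff)
    then show ?thesis
      by simp
  qed
  then have "\<exists>c. \<forall>r\<in>{0..1}. f r = c"
    by (intro has_derivative_zero_constant) auto
  then have "f 1 = f 0"
    by force
  moreover have "bump y t (- J) = stopped_left w t"
    by (simp add: y_def J_def bump_minus_jump)
  ultimately show ?thesis
    by (simp add: f_def y_def g_def J_def inner_commute)
qed

section \<open>Step paths and Riemann sums\<close>

locale partitions =
  fixes \<pi> :: "nat \<Rightarrow> real list"
  assumes partition_seq: "partition_seq \<pi>"
begin

lemma nth_less: "i < j \<Longrightarrow> j < length (\<pi> n) \<Longrightarrow> \<pi> n ! i < \<pi> n ! j"
  using partition_seq unfolding partition_seq_def by (metis sorted_wrt_nth_less)

lemma nth_le: "i \<le> j \<Longrightarrow> j < length (\<pi> n) \<Longrightarrow> \<pi> n ! i \<le> \<pi> n ! j"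
  using nth_less[of i j n] by (cases "i = j") auto

lemma nth_less_iff:
  "i < length (\<pi> n) \<Longrightarrow> j < length (\<pi> n) \<Longrightarrow> \<pi> n ! i < \<pi> n ! j \<longleftrightarrow> i < j"
  using nth_less nth_le by (metis not_le)

lemma nth_zero: "\<pi> n ! 0 = 0"
  using partition_seq unfolding partition_seq_def by (metis hd_conv_nth)

lemma nth_nonneg: "i < length (\<pi> n) \<Longrightarrow> 0 \<le> \<pi> n ! i"
  using nth_le[of 0 i n] by (simp add: nth_zero)

text \<open>Take the least index at which \<open>P\<close> holds; it has a predecessor because
  \<open>P\<close> fails at the first point, which is 0. With \<open>P\<close> of the form
  \<open>t \<le> s\<close> or \<open>t < s\<close> this finds the partition interval around
  \<open>t\<close>.\<close>

lemma crossing_index: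
  assumes "P (last (\<pi> n))" and "\<not> P 0"
  obtains j where "Suc j < length (\<pi> n)" and "\<not> P (\<pi> n ! j)" and "P (\<pi> n ! Suc j)"
proof -
  define k where "k = (LEAST i. P (\<pi> n ! i))"
  have ne: "\<pi> n \<noteq> []"
    using partition_seq by (simp add: partition_seq_def)
  then have last: "P (\<pi> n ! (length (\<pi> n) - 1))"
    using assms(1) by (simp add: last_conv_nth)
  have k: "P (\<pi> n ! k)" "k \<le> length (\<pi> n) - 1"
    unfolding k_def using LeastI[of "\<lambda>i. P (\<pi> n ! i)"] Least_le[of "\<lambda>i. P (\<pi> n ! i)"] last by auto
  then obtain j where j: "k = Suc j"
    using assms(2) nth_zero by (metis not0_implies_Suc)
  then have "\<not> P (\<pi> n ! j)"
    using not_less_Least[of j "\<lambda>i. P (\<pi> n ! i)"] unfolding k_def by simp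
  moreover have "Suc j < length (\<pi> n)"
    using k(2) j ne by (cases "\<pi> n") auto
  ultimately show ?thesis
    using that k(1) j by simp
qed

lemma eventually_less_last: "\<forall>\<^sub>F n in sequentially. t < last (\<pi> n)"
  using partition_seq unfolding partition_seq_def filterlim_at_top_dense by blast

lemma eventually_mesh:
  assumes "0 \<le> t" and "\<epsilon> > 0"
  shows "\<forall>\<^sub>F n in sequentially. \<forall>i. Suc i < length (\<pi> n) \<and> \<pi> n ! i \<le> t \<longrightarrow>
    \<pi> n ! Suc i - \<pi> n ! i < \<epsilon>"
  using partition_seq assms unfolding partition_seq_def by blast

section \<open>Values, left limits and jumps of step paths\<close>

lemma step_path_eq:
  assumes "Suc i < length (\<pi> n)" and "\<pi> n ! i \<le> s" and "s < \<pi> n ! Suc i"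
  shows "step_path \<pi> n x s = x (\<pi> n ! Suc i)"
proof -
  have other: "indicator {\<pi> n ! k ..< \<pi> n ! Suc k} s = (0 :: real)"
    if "Suc k < length (\<pi> n)" "k \<noteq> i" for k
  proof (cases "k < i")
    case True
    then have "\<pi> n ! Suc k \<le> \<pi> n ! i"
      using assms by (intro nth_le) auto
    then show ?thesis
      using assms by (simp add: indicator_def)
  next
    case False
    then have "\<pi> n ! Suc i \<le> \<pi> n ! k"
      using that by (intro nth_le) auto
    then show ?thesis
      using assms by (simp add: indicator_def)
  qed
  have "finite {i. Suc i < length (\<pi> n)}"
    by (rule finite_subset[of _ "{..<length (\<pi> n)}"]) auto
  then have "step_path \<pi> n x s = (\<Sum>k | Suc k < length (\<pi> n).
      if k = i then x (\<pi> n ! Suc i) else 0)"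
    unfolding step_path_def using other assms by (intro sum.cong) (auto simp: indicator_def)
  then show ?thesis
    using assms \<open>finite {i. Suc i < length (\<pi> n)}\<close> by simp
qed

lemma stopped_step_path:
  assumes "Suc i < length (\<pi> n)" and "\<pi> n ! i \<le> t" and "t < \<pi> n ! Suc i"
  shows "stopped (step_path \<pi> n x) t = stopped (step_path \<pi> n x) (\<pi> n ! i)"
proof
  fix s
  show "stopped (step_path \<pi> n x) t s = stopped (step_path \<pi> n x) (\<pi> n ! i) s"
  proof (cases "s < \<pi> n ! i")
    case False
    then show ?thesis
      using step_path_eq[OF assms(1), of "min s t" x]
        step_path_eq[OF assms(1), of "\<pi> n ! i" x] nth_less[of i "Suc i" n] assms
      by (auto simp: stopped_def min_def)
  qed (use assms in \<open>simp add: stopped_def\<close>)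
qed

lemma left_val_step_path:
  assumes "Suc i < length (\<pi> n)"
  shows "left_val (step_path \<pi> n x) (\<pi> n ! Suc i) = x (\<pi> n ! Suc i)"
proof (rule left_val_eqI)
  show "\<pi> n ! i < \<pi> n ! Suc i" "0 < \<pi> n ! Suc i"
    using nth_less[of i "Suc i" n] nth_less[of 0 "Suc i" n] assms by (auto simp: nth_zero)
qed (use step_path_eq assms in blast)

lemma stopped_left_step_path:
  assumes "Suc i < length (\<pi> n)"
  shows "stopped_left (step_path \<pi> n x) (\<pi> n ! Suc i) = stopped (step_path \<pi> n x) (\<pi> n ! i)"
proof
  fix s
  have "step_path \<pi> n x (\<pi> n ! i) = x (\<pi> n ! Suc i)"
    using step_path_eq[OF assms, of "\<pi> n ! i"] nth_less[of i "Suc i"] assms by auto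
  then show "stopped_left (step_path \<pi> n x) (\<pi> n ! Suc i) s =
      stopped (step_path \<pi> n x) (\<pi> n ! i) s"
    using step_path_eq[OF assms, of s] nth_less[of i "Suc i" n] assms
    by (auto simp: stopped_left_def stopped_def left_val_step_path min_def)
qed

text \<open>A step path takes on each interval the value of \<open>x\<close> at its right end. Hence
  its jump at a partition point is the increment of \<open>x\<close> over the interval that follows,
  which is the increment in the Riemann summand starting there. The first point 0 is left out: no
  jump occurs at it.\<close>

lemma jump_step_path:
  assumes "Suc (Suc i) < length (\<pi> n)"
  shows "jump (step_path \<pi> n x) (\<pi> n ! Suc i) = x (\<pi> n ! Suc (Suc i)) - x (\<pi> n ! Suc i)"
  using assms step_path_eq[OF assms, of "\<pi> n ! Suc i"] nth_less[of "Suc i" "Suc (Suc i)"]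
  by (simp add: jump_def left_val_step_path)

lemma step_path_cong:
  assumes "\<And>i. Suc i < length (\<pi> n) \<Longrightarrow> \<pi> n ! i \<le> s \<Longrightarrow> s < \<pi> n ! Suc i \<Longrightarrow>
    x (\<pi> n ! Suc i) = y (\<pi> n ! Suc i)"
  shows "step_path \<pi> n x s = step_path \<pi> n y s"
  unfolding step_path_def using assms by (intro sum.cong) (auto simp: indicator_def)

lemma summation_indices:
  assumes "Suc j < length (\<pi> n)" and "\<pi> n ! j \<le> t" and "t < \<pi> n ! Suc j"
  shows "{i. Suc i < length (\<pi> n) \<and> \<pi> n ! i \<le> t} = {..j}"
proof -
  have "i \<le> j" if "Suc i < length (\<pi> n)" "\<pi> n ! i \<le> t" for i
    using nth_le[of "Suc j" i n] that assms by fastforce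
  moreover have "\<pi> n ! i \<le> t" if "i \<le> j" for i
    using nth_le[of i j n] that assms by simp
  ultimately show ?thesis
    using assms(1) by auto
qed

section \<open>The last partition point before a given time\<close>

lemma prev_pt_le: "0 \<le> t \<Longrightarrow> prev_pt \<pi> n t \<le> t"
  unfolding prev_pt_def by (auto intro: less_imp_le)

lemma prev_pt_nonneg: "0 \<le> prev_pt \<pi> n t"
proof -
  have "s \<ge> 0" if "s \<in> set (\<pi> n)" for s
    using that nth_nonneg by (auto simp: in_set_conv_nth)
  moreover have "Max {s \<in> set (\<pi> n). s < t} \<in> {s \<in> set (\<pi> n). s < t}"
    if "{s \<in> set (\<pi> n). s < t} \<noteq> {}"
    using that by (intro Max_in) auto
  ultimately show ?thesis
    unfolding prev_pt_def by (smt (verit) mem_Collect_eq)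
qed

lemma prev_pt_zero: "prev_pt \<pi> n 0 = 0"
  using prev_pt_le[of 0] prev_pt_nonneg[of n 0] by (simp add: antisym)

lemma prev_pt_eq:
  assumes "Suc j < length (\<pi> n)" and "\<pi> n ! j < t" and "t \<le> \<pi> n ! Suc j"
  shows "prev_pt \<pi> n t = \<pi> n ! j"
proof -
  have "s \<le> \<pi> n ! j" if s: "s \<in> set (\<pi> n)" "s < t" for s
  proof -
    obtain i where i: "i < length (\<pi> n)" "s = \<pi> n ! i"
      using s by (auto simp: in_set_conv_nth)
    then have "\<pi> n ! i < \<pi> n ! Suc j"
      using s assms by simp
    then have "i \<le> j"
      using i assms(1) by (simp add: nth_less_iff)
    then show ?thesis
      using i assms(1) nth_le by simp
  qed
  moreover have "\<pi> n ! j \<in> {s \<in> set (\<pi> n). s < t}"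
    using assms by auto
  ultimately show ?thesis
    unfolding prev_pt_def by (auto intro!: Max_eqI)
qed

text \<open>Once the partition reaches beyond \<open>t\<close>, the time \<open>t\<close> lies in a
  partition interval starting at \<open>prev_pt \<pi> n t\<close>, whose length is small by the mesh
  condition.\<close>

lemma prev_pt_tendsto:
  assumes "0 < t"
  shows "(\<lambda>n. prev_pt \<pi> n t) \<longlonglongrightarrow> t"
proof (rule LIMSEQ_I)
  fix r :: real
  assume "0 < r"
  have "\<forall>\<^sub>F n in sequentially. norm (prev_pt \<pi> n t - t) < r"
    using eventually_mesh[OF less_imp_le[OF assms] \<open>0 < r\<close>] eventually_less_last[of t]
  proof eventually_elim
    case (elim n)
    obtain j where "Suc j < length (\<pi> n)" "\<pi> n ! j < t" "t \<le> \<pi> n ! Suc j"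
      using crossing_index[of "\<lambda>s. t \<le> s" n] elim assms by (auto simp: not_le)
    then show ?case
      using elim prev_pt_eq[of j n t] by force
  qed
  then show "\<exists>N. \<forall>n\<ge>N. norm (prev_pt \<pi> n t - t) < r"
    by (simp add: eventually_sequentially)
qed

section \<open>Riemann sums under stopping and bumping\<close>

text \<open>Summands that start after \<open>t\<close> have zero increments. This is why the
  horizontal derivative of the integral vanishes.\<close>

lemma riemann_sum_stopped:
  assumes "\<And>s. t \<le> s \<Longrightarrow> x s = x t" and "t \<le> t'"
  shows "riemann_sum \<pi> n \<phi> t' x = riemann_sum \<pi> n \<phi> t x"
  unfolding riemann_sum_def
proof (rule sum.mono_neutral_right)
  show "finite {i. Suc i < length (\<pi> n) \<and> \<pi> n ! i \<le> t'}"
    by (rule finite_subset[of _ "{..<length (\<pi> n)}"]) auto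
  show "\<forall>i\<in>{i. Suc i < length (\<pi> n) \<and> \<pi> n ! i \<le> t'} - {i. Suc i < length (\<pi> n) \<and> \<pi> n ! i \<le> t}.
    \<phi> (\<pi> n ! i) (stopped_left (step_path \<pi> n x) (\<pi> n ! i)) \<bullet> (x (\<pi> n ! Suc i) - x (\<pi> n ! i)) = 0"
  proof
    fix i
    assume "i \<in> {i. Suc i < length (\<pi> n) \<and> \<pi> n ! i \<le> t'} -
      {i. Suc i < length (\<pi> n) \<and> \<pi> n ! i \<le> t}"
    then have "t \<le> \<pi> n ! i" "t \<le> \<pi> n ! Suc i"
      using nth_less[of i "Suc i" n] by auto
    then have "x (\<pi> n ! Suc i) = x (\<pi> n ! i)"
      using assms(1) by metis
    then show "\<phi> (\<pi> n ! i) (stopped_left (step_path \<pi> n x) (\<pi> n ! i)) \<bullet>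
        (x (\<pi> n ! Suc i) - x (\<pi> n ! i)) = 0"
      by simp
  qed
qed (use assms(2) in auto)

text \<open>The bump raises \<open>y\<close> at partition points from \<open>t\<close> on. Only the
  interval that starts before \<open>t\<close> and ends at or after \<open>t\<close> has one raised
  end, so one increment gains \<open>e\<close>; its integrand uses \<open>y\<close> only at points
  before \<open>t\<close>.\<close>

lemma riemann_sum_bump:
  assumes y: "\<And>s. t \<le> s \<Longrightarrow> y s = y t" and "t \<le> last (\<pi> n)"
    and first: "Suc 0 < length (\<pi> n) \<longrightarrow> \<pi> n ! Suc 0 < t" and "0 < t"
  shows "riemann_sum \<pi> n \<phi> t (bump y t e) = riemann_sum \<pi> n \<phi> t y +
    \<phi> (prev_pt \<pi> n t) (stopped_left (step_path \<pi> n y) (prev_pt \<pi> n t)) \<bullet> e"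
proof -
  obtain j where j: "Suc j < length (\<pi> n)" "\<pi> n ! j < t" "t \<le> \<pi> n ! Suc j"
    using crossing_index[of "\<lambda>s. t \<le> s" n] assms by (auto simp: not_le)
  \<comment> \<open>For \<open>j = 0\<close> the integrand would be taken at time 0, where the left
    value of the step path is \<open>y (\<pi> n ! Suc 0)\<close>, already affected by the
    bump.\<close>
  have "j \<noteq> 0"
    using j first by (intro notI) auto
  define I where "I = {i. Suc i < length (\<pi> n) \<and> \<pi> n ! i \<le> t}"
  have "finite I"
    unfolding I_def by (rule finite_subset[of _ "{..<length (\<pi> n)}"]) auto
  define z where "z = bump y t e"
  have z: "z s = (if s < t then y s else y t + e)" for s
    using y[of s] by (auto simp: z_def bump_def indicator_def)
  define \<alpha> where "\<alpha> x i = \<phi> (\<pi> n ! i) (stopped_left (step_path \<pi> n x) (\<pi> n ! i))" for x i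
  have summand: "\<alpha> z i \<bullet> (z (\<pi> n ! Suc i) - z (\<pi> n ! i)) =
      \<alpha> y i \<bullet> (y (\<pi> n ! Suc i) - y (\<pi> n ! i)) + (if i = j then \<alpha> y j \<bullet> e else 0)"
    if "i \<in> I" for i
  proof (cases "i \<le> j")
    case True
    have step: "step_path \<pi> n z s = step_path \<pi> n y s" if "s < \<pi> n ! j" for s
    proof (rule step_path_cong)
      fix k
      assume k: "Suc k < length (\<pi> n)" "\<pi> n ! k \<le> s" "s < \<pi> n ! Suc k"
      then have "\<pi> n ! k < \<pi> n ! j"
        using that by simp
      then have "Suc k \<le> j"
        using k j by (simp add: nth_less_iff Suc_le_eq)
      then have "\<pi> n ! Suc k < t"
        using j nth_le[of "Suc k" j n] by simp
      then show "z (\<pi> n ! Suc k) = y (\<pi> n ! Suc k)"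
        by (simp add: z)
    qed
    have "0 < \<pi> n ! j"
      using nth_less[of 0 j n] \<open>j \<noteq> 0\<close> j by (simp add: nth_zero)
    have le: "\<pi> n ! i \<le> \<pi> n ! j"
      using True j nth_le by simp
    then have "stopped_left (step_path \<pi> n z) (\<pi> n ! i) = stopped_left (step_path \<pi> n y) (\<pi> n ! i)"
      using step \<open>0 < \<pi> n ! j\<close> by (intro stopped_left_cong) auto
    then have "\<alpha> z i = \<alpha> y i"
      by (simp add: \<alpha>_def)
    moreover have "z (\<pi> n ! i) = y (\<pi> n ! i)"
      using le j by (simp add: z)
    moreover have "z (\<pi> n ! Suc i) = y (\<pi> n ! Suc i) + (if i = j then e else 0)"
    proof (cases "i = j")
      case False
      then have "\<pi> n ! Suc i < t"
        using True j nth_le[of "Suc i" j n] by simp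
      then show ?thesis
        using False by (simp add: z)
    qed (use j y[of "\<pi> n ! Suc j"] in \<open>simp add: z\<close>)
    ultimately show ?thesis
      by (simp add: inner_diff_right inner_add_right)
  next
    \<comment> \<open>Here the integrands for \<open>z\<close> and \<open>y\<close> may differ, but
      both increments are 0.\<close>
    case False
    then have "t \<le> \<pi> n ! i" "t \<le> \<pi> n ! Suc i"
      using j nth_le[of "Suc j" i n] nth_le[of "Suc j" "Suc i" n] that by (auto simp: I_def)
    then show ?thesis
      using False y[of "\<pi> n ! i"] y[of "\<pi> n ! Suc i"] by (simp add: z)
  qed
  have "riemann_sum \<pi> n \<phi> t z = (\<Sum>i\<in>I. \<alpha> z i \<bullet> (z (\<pi> n ! Suc i) - z (\<pi> n ! i)))"
    by (simp add: riemann_sum_def I_def \<alpha>_def)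
  also have "\<dots> = (\<Sum>i\<in>I. \<alpha> y i \<bullet> (y (\<pi> n ! Suc i) - y (\<pi> n ! i))) +
      (\<Sum>i\<in>I. if i = j then \<alpha> y j \<bullet> e else 0)"
    using summand by (simp add: sum.distrib)
  also have "(\<Sum>i\<in>I. if i = j then \<alpha> y j \<bullet> e else 0) = \<alpha> y j \<bullet> e"
    using \<open>finite I\<close> j by (simp add: I_def)
  finally show ?thesis
    using prev_pt_eq[OF j] by (simp add: z_def riemann_sum_def I_def \<alpha>_def)
qed

section \<open>Telescoping along a step path\<close>

text \<open>Induction on the index of the interval containing \<open>t\<close>. Time moves back
  along the flat piece to the left end without changing \<open>F\<close>, the jump there contributes
  one summand, and stopping just before that end is stopping at the previous partition point. The
  sum starts at 1 as there is no jump at 0.\<close>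

lemma step_path_increment:
  fixes F :: "real \<Rightarrow> 'm::finite path \<Rightarrow> real"
  assumes gen: "generic \<pi> \<Omega>" and cont: "cont_functional \<pi> \<Omega> F"
    and diff: "differentiable_functional \<Omega> F"
    and zero: "\<forall>(t, y)\<in>Lambda \<Omega>. hderiv F t y = 0"
    and grad: "\<forall>(t, y)\<in>Lambda \<Omega>. vgrad F t y = left_version \<phi> t y"
    and mem: "stopped (step_path \<pi> n x) T \<in> \<Omega>"
    and "Suc j < length (\<pi> n)" and "\<pi> n ! j \<le> t" and "t < \<pi> n ! Suc j" and "t \<le> T"
  shows "F t (stopped (step_path \<pi> n x) t) - F 0 (stopped (step_path \<pi> n x) 0) =
    (\<Sum>i = 1..j. \<phi> (\<pi> n ! i) (stopped_left (step_path \<pi> n x) (\<pi> n ! i)) \<bullet>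
      (x (\<pi> n ! Suc i) - x (\<pi> n ! i)))"
proof -
  let ?X = "step_path \<pi> n x"
  have stopped_mem: "stopped ?X s \<in> \<Omega>" if "0 \<le> s" "s \<le> T" for s
    using generic_stopped[OF gen mem that(1)] that by (simp add: stopped_stopped)
  have flat: "F b (stopped ?X a) = F a (stopped ?X a)" if "0 \<le> a" "a \<le> b" "a \<le> T" for a b
    using that by (intro flat_path_constant[OF cont diff zero stopped_mem])
      (auto simp: stopped_stopped)
  show ?thesis
    using assms(7-)
  proof (induction j arbitrary: t)
    case 0
    then have "F t (stopped ?X t) = F t (stopped ?X (\<pi> n ! 0))"
      by (simp only: stopped_step_path[OF 0(1-3)])
    also have "\<dots> = F 0 (stopped ?X 0)"
      using 0 flat[of 0 t] by (simp add: nth_zero)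
    finally show ?case
      by simp
  next
    case (Suc j)
    define a where "a = \<pi> n ! j"
    define b where "b = \<pi> n ! Suc j"
    have ab: "0 \<le> a" "a < b" "b \<le> T" "b \<le> t"
      using Suc.prems nth_nonneg[of j n] nth_less[of j "Suc j" n] by (auto simp: a_def b_def)
    have "F t (stopped ?X t) = F t (stopped ?X b)"
      by (simp only: stopped_step_path[OF Suc.prems(1-3)] b_def)
    also have "\<dots> = F b (stopped ?X b)"
      using ab by (intro flat) auto
    finally have "F t (stopped ?X t) = F b (stopped ?X b)" .
    moreover have "F b (stopped ?X b) - F b (stopped_left ?X b) =
        \<phi> b (stopped_left ?X b) \<bullet> (x (\<pi> n ! Suc (Suc j)) - x b)"
      using jump_increment[OF gen diff grad mem, of b] ab jump_step_path[OF Suc.prems(1), of x]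
      by (simp add: stopped_stopped stopped_left_stopped jump_stopped b_def)
    moreover have "F b (stopped_left ?X b) = F a (stopped ?X a)"
      using stopped_left_step_path[of j n x] Suc.prems(1) flat[of a b] ab by (simp add: a_def b_def)
    moreover have "F a (stopped ?X a) - F 0 (stopped ?X 0) =
        (\<Sum>i = 1..j. \<phi> (\<pi> n ! i) (stopped_left ?X (\<pi> n ! i)) \<bullet> (x (\<pi> n ! Suc i) - x (\<pi> n ! i)))"
      using Suc.prems ab by (intro Suc.IH) (auto simp: a_def b_def)
    ultimately show ?case
      by (simp add: b_def)
  qed
qed

text \<open>The second partition point is positive and tends to 0 by the mesh condition at
  \<open>T = 0\<close>, so right-continuity of \<open>x\<close> applies. This makes the increment in
  the first Riemann summand negligible.\<close>

lemma first_point_tendsto: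
  fixes x :: "'m::finite path"
  assumes "x \<in> cadlag_paths"
  shows "(\<lambda>n. x (\<pi> n ! Suc 0)) \<longlonglongrightarrow> x 0"
proof -
  have pos: "\<forall>\<^sub>F n in sequentially. Suc 0 < length (\<pi> n)"
    using eventually_less_last[of 0]
  proof eventually_elim
    case (elim n)
    obtain j where "Suc j < length (\<pi> n)"
      using crossing_index[of "\<lambda>s. 0 < s" n] elim by auto
    then show ?case
      by simp
  qed
  have "(\<lambda>n. \<pi> n ! Suc 0) \<longlonglongrightarrow> 0"
  proof (rule LIMSEQ_I)
    fix r :: real
    assume "0 < r"
    have "\<forall>\<^sub>F n in sequentially. norm (\<pi> n ! Suc 0 - 0) < r"
      using eventually_mesh[OF order_refl \<open>0 < r\<close>] pos
    proof eventually_elim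
      case (elim n)
      then have "\<pi> n ! Suc 0 - \<pi> n ! 0 < r" "0 \<le> \<pi> n ! Suc 0"
        using nth_zero[of n] nth_nonneg[of "Suc 0" n] by auto
      then show ?case
        by (simp add: nth_zero)
    qed
    then show "\<exists>N. \<forall>n\<ge>N. norm (\<pi> n ! Suc 0 - 0) < r"
      by (simp add: eventually_sequentially)
  qed
  moreover have "\<forall>\<^sub>F n in sequentially. \<pi> n ! Suc 0 > 0"
    using pos
  proof eventually_elim
    case (elim n)
    then show ?case
      using nth_less[of 0 "Suc 0" n] by (simp add: nth_zero)
  qed
  ultimately have "filterlim (\<lambda>n. \<pi> n ! Suc 0) (at_right 0) sequentially"
    by (rule tendsto_imp_filterlim_at_right)
  then show ?thesis
    using cadlag_tendsto_right[OF assms order_refl] by (rule filterlim_compose[rotated])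
qed

section \<open>Continuity of modified functionals\<close>

text \<open>Every path in the definition lies in \<open>\<Omega>\<close> and is stopped at its time,
  for step paths at least when \<open>n\<close> is large. Agreement on
  \<open>Lambda \<Omega>\<close> therefore suffices for the limits to carry over.\<close>

lemma left_cont_cong:
  fixes F G :: "real \<Rightarrow> 'm::finite path \<Rightarrow> 'b::topological_space"
  assumes gen: "generic \<pi> \<Omega>" and F: "left_cont \<pi> \<Omega> F"
    and eq: "\<forall>(t, y)\<in>Lambda \<Omega>. F t y = G t y"
  shows "left_cont \<pi> \<Omega> G"
  unfolding left_cont_def
proof (intro allI impI ballI conjI; (elim conjE)?)
  fix t :: real and x :: "'m path"
  assume t: "0 \<le> t" and x: "x \<in> \<Omega>"
  have eq': "F s y = G s y" if "0 \<le> s" "y \<in> \<Omega>" "stopped y s = y" for s y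
    using eq LambdaI[OF that] by blast
  have l: "F s (stopped_left x s) = G s (stopped_left x s)" if "0 \<le> s" for s
    using that x by (auto intro!: eq' generic_stopped_left[OF gen] stopped_stopped_left_self)
  have r: "F s (stopped x s) = G s (stopped x s)" if "0 \<le> s" for s
    using that x by (auto intro!: eq' generic_stopped[OF gen] stopped_stopped)
  have "((\<lambda>s. F s (stopped_left x s)) \<longlongrightarrow> G t (stopped_left x t)) (at t within {0..t})"
    using F t x unfolding left_cont_def l[OF t, symmetric] by blast
  then show "((\<lambda>s. G s (stopped_left x s)) \<longlongrightarrow> G t (stopped_left x t)) (at t within {0..t})"
    by (rule Lim_transform_eventually) (auto simp: eventually_at_filter l)
  have "((\<lambda>s. F s (stopped x s)) \<longlongrightarrow> G t (stopped_left x t)) (at t within {0..<t})"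
    using F t x unfolding left_cont_def l[OF t, symmetric] by blast
  then show "((\<lambda>s. G s (stopped x s)) \<longlongrightarrow> G t (stopped_left x t)) (at t within {0..<t})"
    by (rule Lim_transform_eventually) (auto simp: eventually_at_filter r)
  fix u
  assume u: "u \<longlonglongrightarrow> t"
  { assume b: "\<forall>n. 0 \<le> u n \<and> u n \<le> prev_pt \<pi> n t"
    then have "(\<lambda>n. F (u n) (stopped_left (step_path \<pi> n x) (u n))) \<longlonglongrightarrow> G t (stopped_left x t)"
      using F t x u unfolding left_cont_def l[OF t, symmetric] by blast
    moreover have "\<forall>\<^sub>F n in sequentially. F (u n) (stopped_left (step_path \<pi> n x) (u n)) =
        G (u n) (stopped_left (step_path \<pi> n x) (u n))"
      using generic_step[OF gen x u] b
      by (auto elim!: eventually_mono intro!: eq' stopped_stopped_left_self)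
    ultimately show "(\<lambda>n. G (u n) (stopped_left (step_path \<pi> n x) (u n))) \<longlonglongrightarrow>
        G t (stopped_left x t)"
      by (rule Lim_transform_eventually) }
  { assume b: "\<forall>n. 0 \<le> u n \<and> u n < prev_pt \<pi> n t"
    then have "(\<lambda>n. F (u n) (stopped (step_path \<pi> n x) (u n))) \<longlonglongrightarrow> G t (stopped_left x t)"
      using F t x u unfolding left_cont_def l[OF t, symmetric] by blast
    moreover have "\<forall>\<^sub>F n in sequentially. F (u n) (stopped (step_path \<pi> n x) (u n)) =
        G (u n) (stopped (step_path \<pi> n x) (u n))"
      using generic_step[OF gen x u] b
      by (auto elim!: eventually_mono intro!: eq' stopped_stopped)
    ultimately show "(\<lambda>n. G (u n) (stopped (step_path \<pi> n x) (u n))) \<longlonglongrightarrow>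
        G t (stopped_left x t)"
      by (rule Lim_transform_eventually) }
qed

lemma right_cont_cong:
  fixes F G :: "real \<Rightarrow> 'm::finite path \<Rightarrow> 'b::topological_space"
  assumes gen: "generic \<pi> \<Omega>" and F: "right_cont \<pi> \<Omega> F"
    and eq: "\<forall>(t, y)\<in>Lambda \<Omega>. F t y = G t y"
  shows "right_cont \<pi> \<Omega> G"
  unfolding right_cont_def
proof (intro allI impI ballI conjI; (elim conjE)?)
  fix t :: real and x :: "'m path"
  assume t: "0 \<le> t" and x: "x \<in> \<Omega>"
  have eq': "F s y = G s y" if "0 \<le> s" "y \<in> \<Omega>" "stopped y s = y" for s y
    using eq LambdaI[OF that] by blast
  have l: "F s (stopped_left x s) = G s (stopped_left x s)" if "0 \<le> s" for s
    using that x by (auto intro!: eq' generic_stopped_left[OF gen] stopped_stopped_left_self)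
  have r: "F s (stopped x s) = G s (stopped x s)" if "0 \<le> s" for s
    using that x by (auto intro!: eq' generic_stopped[OF gen] stopped_stopped)
  have "((\<lambda>s. F s (stopped x s)) \<longlongrightarrow> G t (stopped x t)) (at t within {t..})"
    using F t x unfolding right_cont_def r[OF t, symmetric] by blast
  then show "((\<lambda>s. G s (stopped x s)) \<longlongrightarrow> G t (stopped x t)) (at t within {t..})"
    by (rule Lim_transform_eventually) (use t in \<open>auto simp: eventually_at_filter r\<close>)
  have "((\<lambda>s. F s (stopped_left x s)) \<longlongrightarrow> G t (stopped x t)) (at t within {t<..})"
    using F t x unfolding right_cont_def r[OF t, symmetric] by blast
  then show "((\<lambda>s. G s (stopped_left x s)) \<longlongrightarrow> G t (stopped x t)) (at t within {t<..})"
    by (rule Lim_transform_eventually) (use t in \<open>auto simp: eventually_at_filter l\<close>)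
  fix u
  assume u: "u \<longlonglongrightarrow> t"
  { assume b: "\<forall>n. 0 \<le> u n \<and> u n \<ge> prev_pt \<pi> n t"
    then have "(\<lambda>n. F (u n) (stopped (step_path \<pi> n x) (u n))) \<longlonglongrightarrow> G t (stopped x t)"
      using F t x u unfolding right_cont_def r[OF t, symmetric] by blast
    moreover have "\<forall>\<^sub>F n in sequentially. F (u n) (stopped (step_path \<pi> n x) (u n)) =
        G (u n) (stopped (step_path \<pi> n x) (u n))"
      using generic_step[OF gen x u] b
      by (auto elim!: eventually_mono intro!: eq' stopped_stopped)
    ultimately show "(\<lambda>n. G (u n) (stopped (step_path \<pi> n x) (u n))) \<longlonglongrightarrow>
        G t (stopped x t)"
      by (rule Lim_transform_eventually) }
  { assume b: "\<forall>n. 0 \<le> u n \<and> u n > prev_pt \<pi> n t"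
    then have "(\<lambda>n. F (u n) (stopped_left (step_path \<pi> n x) (u n))) \<longlonglongrightarrow> G t (stopped x t)"
      using F t x u unfolding right_cont_def r[OF t, symmetric] by blast
    moreover have "\<forall>\<^sub>F n in sequentially. F (u n) (stopped_left (step_path \<pi> n x) (u n)) =
        G (u n) (stopped_left (step_path \<pi> n x) (u n))"
      using generic_step[OF gen x u] b
      by (auto elim!: eventually_mono intro!: eq' stopped_stopped_left_self)
    ultimately show "(\<lambda>n. G (u n) (stopped_left (step_path \<pi> n x) (u n))) \<longlonglongrightarrow>
        G t (stopped x t)"
      by (rule Lim_transform_eventually) }
qed

text \<open>At time 0 the convention gives \<open>prev_pt \<pi> n 0 = 0\<close>, so the constant
  sequence 0 is admissible for right-continuity.\<close>

lemma tendsto_step_path_zero: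
  assumes "right_cont \<pi> \<Omega> F" and "x \<in> \<Omega>"
  shows "(\<lambda>n. F 0 (stopped (step_path \<pi> n x) 0)) \<longlonglongrightarrow> F 0 (stopped x 0)"
  using right_cont_step_path[OF assms(1) order_refl assms(2) tendsto_const] by (simp add: prev_pt_zero)

text \<open>The subtracted term is constant in time along a fixed path. Along step paths it varies
  with \<open>n\<close>, but converges by right-continuity at time 0.\<close>

lemma cont_functional_diff_initial:
  fixes F :: "real \<Rightarrow> 'm::finite path \<Rightarrow> real"
  assumes cont: "cont_functional \<pi> \<Omega> F"
  shows "cont_functional \<pi> \<Omega> (\<lambda>t y. F t y - F 0 (stopped y 0))"
proof -
  have F: "left_cont \<pi> \<Omega> F" "right_cont \<pi> \<Omega> F"
    using cont by (auto simp: cont_functional_def)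
  have "left_cont \<pi> \<Omega> (\<lambda>t y. F t y - F 0 (stopped y 0))"
    unfolding left_cont_def
  proof (intro allI impI ballI conjI; (elim conjE)?)
    fix t :: real and x :: "'m path"
    assume t: "0 \<le> t" and x: "x \<in> \<Omega>"
    note zero = tendsto_step_path_zero[OF F(2) x]
    have "((\<lambda>s. F s (stopped_left x s) - F 0 (stopped x 0)) \<longlongrightarrow>
        F t (stopped_left x t) - F 0 (stopped x 0)) (at t within {0..t})"
      using F(1) t x unfolding left_cont_def by (intro tendsto_diff tendsto_const) blast
    then show "((\<lambda>s. F s (stopped_left x s) - F 0 (stopped (stopped_left x s) 0)) \<longlongrightarrow>
        F t (stopped_left x t) - F 0 (stopped (stopped_left x t) 0)) (at t within {0..t})"
      using t by (rule_tac Lim_transform_eventually)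
        (auto simp: eventually_at_filter stopped_stopped_left_zero)
    have "((\<lambda>s. F s (stopped x s) - F 0 (stopped x 0)) \<longlongrightarrow>
        F t (stopped_left x t) - F 0 (stopped x 0)) (at t within {0..<t})"
      using F(1) t x unfolding left_cont_def by (intro tendsto_diff tendsto_const) blast
    then show "((\<lambda>s. F s (stopped x s) - F 0 (stopped (stopped x s) 0)) \<longlongrightarrow>
        F t (stopped_left x t) - F 0 (stopped (stopped_left x t) 0)) (at t within {0..<t})"
      using t by (rule_tac Lim_transform_eventually)
        (auto simp: eventually_at_filter stopped_stopped_left_zero stopped_stopped)
    fix u
    assume u: "u \<longlonglongrightarrow> t"
    { assume b: "\<forall>n. 0 \<le> u n \<and> u n \<le> prev_pt \<pi> n t"
      then have "(\<lambda>n. F (u n) (stopped_left (step_path \<pi> n x) (u n))) \<longlonglongrightarrow> F t (stopped_left x t)"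
        using F(1) t x u unfolding left_cont_def by blast
      from tendsto_diff[OF this zero]
      show "(\<lambda>n. F (u n) (stopped_left (step_path \<pi> n x) (u n)) -
          F 0 (stopped (stopped_left (step_path \<pi> n x) (u n)) 0)) \<longlonglongrightarrow>
          F t (stopped_left x t) - F 0 (stopped (stopped_left x t) 0)"
        using b t by (simp add: stopped_stopped_left_zero) }
    { assume b: "\<forall>n. 0 \<le> u n \<and> u n < prev_pt \<pi> n t"
      then have "(\<lambda>n. F (u n) (stopped (step_path \<pi> n x) (u n))) \<longlonglongrightarrow> F t (stopped_left x t)"
        using F(1) t x u unfolding left_cont_def by blast
      from tendsto_diff[OF this zero]
      show "(\<lambda>n. F (u n) (stopped (step_path \<pi> n x) (u n)) -
          F 0 (stopped (stopped (step_path \<pi> n x) (u n)) 0)) \<longlonglongrightarrow>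
          F t (stopped_left x t) - F 0 (stopped (stopped_left x t) 0)"
        using b t by (simp add: stopped_stopped_left_zero stopped_stopped) }
  qed
  moreover have "right_cont \<pi> \<Omega> (\<lambda>t y. F t y - F 0 (stopped y 0))"
    unfolding right_cont_def
  proof (intro allI impI ballI conjI; (elim conjE)?)
    fix t :: real and x :: "'m path"
    assume t: "0 \<le> t" and x: "x \<in> \<Omega>"
    note zero = tendsto_step_path_zero[OF F(2) x]
    have "((\<lambda>s. F s (stopped x s) - F 0 (stopped x 0)) \<longlongrightarrow>
        F t (stopped x t) - F 0 (stopped x 0)) (at t within {t..})"
      using F(2) t x unfolding right_cont_def by (intro tendsto_diff tendsto_const) blast
    then show "((\<lambda>s. F s (stopped x s) - F 0 (stopped (stopped x s) 0)) \<longlongrightarrow>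
        F t (stopped x t) - F 0 (stopped (stopped x t) 0)) (at t within {t..})"
      using t by (rule_tac Lim_transform_eventually)
        (auto simp: eventually_at_filter stopped_stopped)
    have "((\<lambda>s. F s (stopped_left x s) - F 0 (stopped x 0)) \<longlongrightarrow>
        F t (stopped x t) - F 0 (stopped x 0)) (at t within {t<..})"
      using F(2) t x unfolding right_cont_def by (intro tendsto_diff tendsto_const) blast
    then show "((\<lambda>s. F s (stopped_left x s) - F 0 (stopped (stopped_left x s) 0)) \<longlongrightarrow>
        F t (stopped x t) - F 0 (stopped (stopped x t) 0)) (at t within {t<..})"
      using t by (rule_tac Lim_transform_eventually)
        (auto simp: eventually_at_filter stopped_stopped_left_zero stopped_stopped)
    fix u
    assume u: "u \<longlonglongrightarrow> t"
    { assume b: "\<forall>n. 0 \<le> u n \<and> u n \<ge> prev_pt \<pi> n t"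
      then have "(\<lambda>n. F (u n) (stopped (step_path \<pi> n x) (u n))) \<longlonglongrightarrow> F t (stopped x t)"
        using F(2) t x u unfolding right_cont_def by blast
      from tendsto_diff[OF this zero]
      show "(\<lambda>n. F (u n) (stopped (step_path \<pi> n x) (u n)) -
          F 0 (stopped (stopped (step_path \<pi> n x) (u n)) 0)) \<longlonglongrightarrow>
          F t (stopped x t) - F 0 (stopped (stopped x t) 0)"
        using b t by (simp add: stopped_stopped) }
    { assume b: "\<forall>n. 0 \<le> u n \<and> u n > prev_pt \<pi> n t"
      then have "(\<lambda>n. F (u n) (stopped_left (step_path \<pi> n x) (u n))) \<longlonglongrightarrow> F t (stopped x t)"
        using F(2) t x u unfolding right_cont_def by blast
      from tendsto_diff[OF this zero]
      show "(\<lambda>n. F (u n) (stopped_left (step_path \<pi> n x) (u n)) -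
          F 0 (stopped (stopped_left (step_path \<pi> n x) (u n)) 0)) \<longlonglongrightarrow>
          F t (stopped x t) - F 0 (stopped (stopped x t) 0)"
        using b t by (simp add: stopped_stopped_left_zero stopped_stopped) }
  qed
  ultimately show ?thesis
    by (simp add: cont_functional_def)
qed

section \<open>Path integrals\<close>

lemma path_integral_flat:
  assumes "0 \<le> h"
  shows "path_integral \<pi> \<phi> (t + h) (stopped x t) = path_integral \<pi> \<phi> t (stopped x t)"
  unfolding path_integral_def using assms
  by (subst riemann_sum_stopped[of t "stopped x t" "t + h"]) (auto simp: stopped_def)

lemma path_integral_bump_zero: "path_integral \<pi> \<phi> 0 (bump (stopped x 0) 0 e) = 0"
proof -
  have "riemann_sum \<pi> n \<phi> 0 (bump (stopped x 0) 0 e) = 0" for n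
    unfolding riemann_sum_def
  proof (rule sum.neutral, rule ballI)
    fix i
    assume "i \<in> {i. Suc i < length (\<pi> n) \<and> \<pi> n ! i \<le> 0}"
    then have "0 \<le> \<pi> n ! i" "0 \<le> \<pi> n ! Suc i"
      using nth_nonneg[of i n] nth_nonneg[of "Suc i" n] by auto
    then show "\<phi> (\<pi> n ! i) (stopped_left (step_path \<pi> n (bump (stopped x 0) 0 e)) (\<pi> n ! i)) \<bullet>
        (bump (stopped x 0) 0 e (\<pi> n ! Suc i) - bump (stopped x 0) 0 e (\<pi> n ! i)) = 0"
      by (simp add: bump_def stopped_def)
  qed
  then show ?thesis
    by (simp add: path_integral_def)
qed

text \<open>The bumped path lies in \<open>\<Omega>\<close>, so its Riemann sums converge too. They
  differ from those of the stopped path by one summand, which converges by left-continuity along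
  \<open>prev_pt \<pi> n t\<close>.\<close>

lemma path_integral_bump:
  fixes x :: "'m::finite path"
  assumes gen: "generic \<pi> \<Omega>" and int: "Lambda_integrable \<pi> \<Omega> \<phi>" and "x \<in> \<Omega>" and "0 < t"
    and bump: "bump (stopped x t) t e \<in> \<Omega>"
  shows "path_integral \<pi> \<phi> t (bump (stopped x t) t e) =
    path_integral \<pi> \<phi> t (stopped x t) + left_version \<phi> t (stopped x t) \<bullet> e"
proof -
  define y where "y = stopped x t"
  have y: "y \<in> \<Omega>" "stopped y t = y" "\<And>s. t \<le> s \<Longrightarrow> y s = y t"
    using generic_stopped[OF gen \<open>x \<in> \<Omega>\<close>] \<open>0 < t\<close>
    by (auto simp: y_def stopped_stopped) (simp add: stopped_def)
  have lim: "(\<lambda>n. riemann_sum \<pi> n \<phi> t z) \<longlonglongrightarrow> path_integral \<pi> \<phi> t (stopped z t)" if "z \<in> \<Omega>" for z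
    using int that \<open>0 < t\<close> by (simp add: Lambda_integrable_def)
  have "left_cont \<pi> \<Omega> (left_version \<phi>)"
    using int by (simp add: Lambda_integrable_def)
  from left_cont_step_path[OF this less_imp_le[OF \<open>0 < t\<close>] y(1) prev_pt_tendsto[OF \<open>0 < t\<close>]]
  have "(\<lambda>n. left_version \<phi> (prev_pt \<pi> n t)
      (stopped_left (step_path \<pi> n y) (prev_pt \<pi> n t))) \<longlonglongrightarrow> left_version \<phi> t (stopped_left y t)"
    by (simp add: prev_pt_nonneg)
  \<comment> \<open>Left-continuity is known for \<open>left_version \<phi>\<close> only; at
    left-stopped paths it agrees with \<open>\<phi>\<close>, since stopping from the left twice
    changes nothing.\<close>
  then have "(\<lambda>n. \<phi> (prev_pt \<pi> n t) (stopped_left (step_path \<pi> n y) (prev_pt \<pi> n t))) \<longlonglongrightarrow>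
      left_version \<phi> t y"
    by (simp add: left_version_def)
  then have "(\<lambda>n. riemann_sum \<pi> n \<phi> t y +
      \<phi> (prev_pt \<pi> n t) (stopped_left (step_path \<pi> n y) (prev_pt \<pi> n t)) \<bullet> e) \<longlonglongrightarrow>
      path_integral \<pi> \<phi> t y + left_version \<phi> t y \<bullet> e"
    using lim[OF y(1)] y(2) by (intro tendsto_add tendsto_inner tendsto_const) auto
  moreover have "\<forall>\<^sub>F n in sequentially. riemann_sum \<pi> n \<phi> t y +
      \<phi> (prev_pt \<pi> n t) (stopped_left (step_path \<pi> n y) (prev_pt \<pi> n t)) \<bullet> e =
      riemann_sum \<pi> n \<phi> t (bump y t e)"
    \<comment> \<open>The mesh condition at \<open>T = 0\<close> with tolerance \<open>t\<close>
      puts the second partition point before \<open>t\<close>, as \<open>riemann_sum_bump\<close>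
      demands.\<close>
    using eventually_less_last[of t] eventually_mesh[OF order_refl \<open>0 < t\<close>]
  proof eventually_elim
    case (elim n)
    show ?case
    proof (rule riemann_sum_bump[symmetric])
      show "Suc 0 < length (\<pi> n) \<longrightarrow> \<pi> n ! Suc 0 < t"
        using elim(2)[rule_format, of 0] by (auto simp: nth_zero)
      show "t \<le> last (\<pi> n)"
        using elim by simp
    qed (fact y(3) \<open>0 < t\<close>)+
  qed
  ultimately have "(\<lambda>n. riemann_sum \<pi> n \<phi> t (bump y t e)) \<longlonglongrightarrow>
      path_integral \<pi> \<phi> t y + left_version \<phi> t y \<bullet> e"
    by (rule Lim_transform_eventually)
  moreover have "(\<lambda>n. riemann_sum \<pi> n \<phi> t (bump y t e)) \<longlonglongrightarrow> path_integral \<pi> \<phi> t (bump y t e)"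
    using lim[OF bump] by (simp add: y_def stopped_bump_self)
  ultimately show ?thesis
    using LIMSEQ_unique by (auto simp: y_def)
qed

lemma path_integral_has_hderiv: "has_hderiv (path_integral \<pi> \<phi>) t (stopped x t) 0"
  unfolding has_hderiv_def
proof (rule tendsto_eventually)
  show "\<forall>\<^sub>F h in at_right 0. (path_integral \<pi> \<phi> (t + h) (stopped x t) -
      path_integral \<pi> \<phi> t (stopped x t)) / h = 0"
    by (auto simp: eventually_at_filter path_integral_flat)
qed

text \<open>For \<open>t > 0\<close> the integral is affine in the bump on the neighbourhood given
  by genericity. At \<open>t = 0\<close> it is 0 for every bump, so the whole space serves as
  neighbourhood.\<close>

lemma path_integral_has_vgrad:
  assumes gen: "generic \<pi> \<Omega>" and int: "Lambda_integrable \<pi> \<Omega> \<phi>" and "x \<in> \<Omega>" and "0 \<le> t"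
  shows "has_vgrad (path_integral \<pi> \<phi>) t (stopped x t)
    (if t = 0 then 0 else left_version \<phi> t (stopped x t))"
proof (cases "t = 0")
  case True
  then show ?thesis
    by (intro has_vgrad_affine[of UNIV _ _ _ 0]) (auto simp: path_integral_bump_zero)
next
  case False
  obtain U where "0 \<in> interior U" "\<And>e. e \<in> U \<Longrightarrow> bump (stopped x t) t e \<in> \<Omega>"
    using generic_bump[OF gen \<open>x \<in> \<Omega>\<close> \<open>0 \<le> t\<close>] by metis
  then show ?thesis
    using False \<open>0 \<le> t\<close>
    by (intro has_vgrad_affine[of U _ _ _ "path_integral \<pi> \<phi> t (stopped x t)"])
       (auto intro: path_integral_bump[OF gen int \<open>x \<in> \<Omega>\<close>])
qed

lemma differentiable_path_integral:
  assumes "generic \<pi> \<Omega>" and "Lambda_integrable \<pi> \<Omega> \<phi>"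
  shows "differentiable_functional \<Omega> (path_integral \<pi> \<phi>)"
  unfolding differentiable_functional_def
proof (clarify, intro conjI)
  fix t y
  assume "(t, y) \<in> Lambda \<Omega>"
  then obtain x where x: "x \<in> \<Omega>" "0 \<le> t" and y: "y = stopped x t"
    by (auto simp: Lambda_iff)
  show "\<exists>d. has_hderiv (path_integral \<pi> \<phi>) t y d"
    unfolding y by (rule exI, rule path_integral_has_hderiv)
  show "\<exists>g. has_vgrad (path_integral \<pi> \<phi>) t y g"
    unfolding y by (rule exI, rule path_integral_has_vgrad[OF assms x])
qed

lemma vgrad_path_integral:
  assumes "generic \<pi> \<Omega>" and "Lambda_integrable \<pi> \<Omega> \<phi>"
  shows "\<forall>(t, y)\<in>Lambda \<Omega>. t > 0 \<longrightarrow> vgrad (path_integral \<pi> \<phi>) t y = left_version \<phi> t y"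
proof (clarify)
  fix t :: real and y
  assume "(t, y) \<in> Lambda \<Omega>" and "0 < t"
  then obtain x where x: "x \<in> \<Omega>" "0 \<le> t" and y: "y = stopped x t"
    by (auto simp: Lambda_iff)
  show "vgrad (path_integral \<pi> \<phi>) t y = left_version \<phi> t y"
    using vgrad_eq[OF path_integral_has_vgrad[OF assms x]] \<open>0 < t\<close> by (simp add: y)
qed

section \<open>Functionals of class M as integrals\<close>

lemma riemann_sum_tendsto:
  fixes F :: "real \<Rightarrow> 'm::finite path \<Rightarrow> real"
  assumes gen: "generic \<pi> \<Omega>" and F: "F \<in> class_M \<pi> \<Omega>"
    and grad: "\<forall>(t, y)\<in>Lambda \<Omega>. vgrad F t y = left_version \<phi> t y"
    and left: "left_cont \<pi> \<Omega> (left_version \<phi>)"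
    and x: "x \<in> \<Omega>" and t: "0 \<le> t"
  shows "(\<lambda>n. riemann_sum \<pi> n \<phi> t x) \<longlonglongrightarrow> F t (stopped x t) - F 0 (stopped x 0)"
proof -
  have cont: "cont_functional \<pi> \<Omega> F" and diff: "differentiable_functional \<Omega> F"
    and zero: "\<forall>(t, y)\<in>Lambda \<Omega>. hderiv F t y = 0"
    using F by (auto simp: class_M_def)
  then have right: "right_cont \<pi> \<Omega> F"
    by (simp add: cont_functional_def)
  let ?X = "\<lambda>n. step_path \<pi> n x"
  have "(\<lambda>n. F t (stopped (?X n) t)) \<longlonglongrightarrow> F t (stopped x t)"
    using right_cont_step_path[OF right t x tendsto_const] t prev_pt_le by simp
  moreover have "(\<lambda>n. F 0 (stopped (?X n) 0)) \<longlonglongrightarrow> F 0 (stopped x 0)"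
    using right x by (rule tendsto_step_path_zero)
  \<comment> \<open>The summand at time 0 is the one that telescoping does not produce. Its
    integrand converges and its increment tends to 0.\<close>
  moreover have "(\<lambda>n. \<phi> 0 (stopped_left (?X n) 0) \<bullet> (x (\<pi> n ! Suc 0) - x 0)) \<longlonglongrightarrow>
      \<phi> 0 (stopped_left x 0) \<bullet> (x 0 - x 0)"
  proof (intro tendsto_inner tendsto_diff tendsto_const)
    have "(\<lambda>n. left_version \<phi> 0 (stopped_left (?X n) 0)) \<longlonglongrightarrow>
        left_version \<phi> 0 (stopped_left x 0)"
      using left_cont_step_path[OF left order_refl x tendsto_const] by (simp add: prev_pt_zero)
    then show "(\<lambda>n. \<phi> 0 (stopped_left (?X n) 0)) \<longlonglongrightarrow> \<phi> 0 (stopped_left x 0)"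
      by (simp add: left_version_def)
    show "(\<lambda>n. x (\<pi> n ! Suc 0)) \<longlonglongrightarrow> x 0"
      using gen x by (intro first_point_tendsto) (auto simp: generic_def)
  qed
  ultimately have "(\<lambda>n. F t (stopped (?X n) t) - F 0 (stopped (?X n) 0) +
      \<phi> 0 (stopped_left (?X n) 0) \<bullet> (x (\<pi> n ! Suc 0) - x 0)) \<longlonglongrightarrow>
      F t (stopped x t) - F 0 (stopped x 0) + \<phi> 0 (stopped_left x 0) \<bullet> (x 0 - x 0)"
    by (intro tendsto_add tendsto_diff)
  then have "(\<lambda>n. F t (stopped (?X n) t) - F 0 (stopped (?X n) 0) +
      \<phi> 0 (stopped_left (?X n) 0) \<bullet> (x (\<pi> n ! Suc 0) - x 0)) \<longlonglongrightarrow>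
      F t (stopped x t) - F 0 (stopped x 0)"
    by simp
  moreover have "\<forall>\<^sub>F n in sequentially. F t (stopped (?X n) t) - F 0 (stopped (?X n) 0) +
      \<phi> 0 (stopped_left (?X n) 0) \<bullet> (x (\<pi> n ! Suc 0) - x 0) = riemann_sum \<pi> n \<phi> t x"
    using generic_step[OF gen x tendsto_const t] eventually_less_last[of t]
  proof eventually_elim
    case (elim n)
    obtain j where j: "Suc j < length (\<pi> n)" "\<pi> n ! j \<le> t" "t < \<pi> n ! Suc j"
      using crossing_index[of "\<lambda>s. t < s" n] elim t by (auto simp: not_less)
    have mem: "stopped (?X n) t \<in> \<Omega>"
      using elim by simp
    have "riemann_sum \<pi> n \<phi> t x = (\<Sum>i\<in>insert 0 {1..j}.
        \<phi> (\<pi> n ! i) (stopped_left (?X n) (\<pi> n ! i)) \<bullet> (x (\<pi> n ! Suc i) - x (\<pi> n ! i)))"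
      unfolding riemann_sum_def summation_indices[OF j] by (rule sum.cong) auto
    then show ?case
      using step_path_increment[OF gen cont diff zero grad mem j order_refl]
      by (simp add: nth_zero)
  qed
  ultimately show ?thesis
    by (rule Lim_transform_eventually)
qed

lemma class_M_integrable:
  fixes F :: "real \<Rightarrow> 'm::finite path \<Rightarrow> real"
  assumes gen: "generic \<pi> \<Omega>" and F: "F \<in> class_M \<pi> \<Omega>"
    and grad: "\<forall>(t, y)\<in>Lambda \<Omega>. vgrad F t y = left_version \<phi> t y"
  shows "Lambda_integrable \<pi> \<Omega> \<phi>"
    and "0 \<le> t \<Longrightarrow> x \<in> \<Omega> \<Longrightarrow>
      path_integral \<pi> \<phi> t (stopped x t) = F t (stopped x t) - F 0 (stopped x 0)"
proof -
  \<comment> \<open>Inherited from the gradient of \<open>F\<close>, with which it agrees on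
    \<open>Lambda \<Omega>\<close>.\<close>
  have left: "left_cont \<pi> \<Omega> (left_version \<phi>)"
    using left_cont_cong[OF gen _ grad] F by (simp add: class_M_def)
  note lim = riemann_sum_tendsto[OF gen F grad left]
  have eq: "path_integral \<pi> \<phi> t (stopped x t) = F t (stopped x t) - F 0 (stopped x 0)"
    if "0 \<le> t" "x \<in> \<Omega>" for t x
    \<comment> \<open>The integral at \<open>(t, stopped x t)\<close> is built from the sums of the
      stopped path, which is itself in \<open>\<Omega>\<close>. The sums of \<open>x\<close> have
      the same limit by \<open>lim\<close>, which is what integrability requires.\<close>
    using lim[OF generic_stopped[OF gen that(2,1)] that(1)] that(1)
    unfolding path_integral_def by (auto simp: stopped_stopped intro: limI)
  have eq_Lambda: "\<forall>(t, y)\<in>Lambda \<Omega>. F t y - F 0 (stopped y 0) = path_integral \<pi> \<phi> t y"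
    using eq by (auto simp: Lambda_iff stopped_stopped)
  have "cont_functional \<pi> \<Omega> (\<lambda>t y. F t y - F 0 (stopped y 0))"
    using F by (intro cont_functional_diff_initial) (simp add: class_M_def)
  then have "cont_functional \<pi> \<Omega> (path_integral \<pi> \<phi>)"
    using left_cont_cong[OF gen _ eq_Lambda] right_cont_cong[OF gen _ eq_Lambda]
    by (simp add: cont_functional_def)
  then show "Lambda_integrable \<pi> \<Omega> \<phi>"
    using left lim eq by (simp add: Lambda_integrable_def)
  show "0 \<le> t \<Longrightarrow> x \<in> \<Omega> \<Longrightarrow>
      path_integral \<pi> \<phi> t (stopped x t) = F t (stopped x t) - F 0 (stopped x 0)"
    by (rule eq)
qed

end

theorem corollary5p11:
  fixes \<pi> :: "nat \<Rightarrow> real list" and \<Omega> :: "('m::finite) path set"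
  assumes "partition_seq \<pi>" and "generic \<pi> \<Omega>"
  shows
    "(\<forall>\<phi> :: real \<Rightarrow> 'm path \<Rightarrow> real ^ 'm. Lambda_integrable \<pi> \<Omega> \<phi> \<longrightarrow>
        cont_functional \<pi> \<Omega> (path_integral \<pi> \<phi>) \<and>
        differentiable_functional \<Omega> (path_integral \<pi> \<phi>) \<and>
        (\<forall>(t, y)\<in>Lambda \<Omega>. t > 0 \<longrightarrow> vgrad (path_integral \<pi> \<phi>) t y = left_version \<phi> t y)) \<and>
     (\<forall>(\<phi> :: real \<Rightarrow> 'm path \<Rightarrow> real ^ 'm) (F :: real \<Rightarrow> 'm path \<Rightarrow> real).
        F \<in> class_M \<pi> \<Omega> \<and> (\<forall>(t, y)\<in>Lambda \<Omega>. vgrad F t y = left_version \<phi> t y) \<longrightarrow>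
        Lambda_integrable \<pi> \<Omega> \<phi> \<and>
        (\<forall>t\<ge>0. \<forall>x\<in>\<Omega>.
           path_integral \<pi> \<phi> t (stopped x t) = F t (stopped x t) - F 0 (stopped x 0)))"
proof -
  interpret partitions \<pi>
    by (rule partitions.intro) (rule assms(1))
  show ?thesis
  proof (intro conjI allI impI; (elim conjE)?)
    fix \<phi> :: "real \<Rightarrow> 'm path \<Rightarrow> real ^ 'm"
    assume int: "Lambda_integrable \<pi> \<Omega> \<phi>"
    then show "cont_functional \<pi> \<Omega> (path_integral \<pi> \<phi>)"
      by (simp add: Lambda_integrable_def)
    show "differentiable_functional \<Omega> (path_integral \<pi> \<phi>)"
      using differentiable_path_integral[OF assms(2) int] .
    show "\<forall>(t, y)\<in>Lambda \<Omega>. t > 0 \<longrightarrow> vgrad (path_integral \<pi> \<phi>) t y = left_version \<phi> t y"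
      using vgrad_path_integral[OF assms(2) int] by blast
  next
    fix \<phi> :: "real \<Rightarrow> 'm path \<Rightarrow> real ^ 'm" and F :: "real \<Rightarrow> 'm path \<Rightarrow> real"
    assume F: "F \<in> class_M \<pi> \<Omega>" "\<forall>(t, y)\<in>Lambda \<Omega>. vgrad F t y = left_version \<phi> t y"
    show "Lambda_integrable \<pi> \<Omega> \<phi>"
      using assms(2) F by (rule class_M_integrable(1))
    show "\<forall>x\<in>\<Omega>. path_integral \<pi> \<phi> t (stopped x t) = F t (stopped x t) - F 0 (stopped x 0)"
      if "0 \<le> t" for t
      using class_M_integrable(2)[OF assms(2) F that] by (rule ballI)
  qed
qed

end
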